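(* Let $m,n$ be integers such that either $2\le m\le 5$ and $n\ge 2$, or $m=n=6$. Then there exist a finite alphabet $\Sigma$ and regular languages $K,L$ over $\Sigma$ with $\kappa(K)=m$ and $\kappa(L)=n$ such that $\kappa(K \sqcup\!\sqcup L)=f(m,n)$, where $$f(m,n)=2^{mn-1} + 2^{(m-1)(n-1)}(2^{m-1}-1)(2^{n-1}-1).$$
   Context: The state complexity $\kappa(L)$ of a regular language $L$ over $\Sigma$ is the number of states of the minimal complete deterministic finite automaton over $\Sigma$ recognizing $L$. The shuffle of words $u,v\in\Sigma^*$ is $u \sqcup\!\sqcup v=\{u_1v_1\cdots u_kv_k \mid u=u_1\cdots u_k,\ v=v_1\cdots v_k,\ u_1,\ldots,u_k,v_1,\ldots,v_k\in\Sigma^*\}$, and the shuffle of languages $K,L\subseteq\Sigma^*$ is $K \sqcup\!\sqcup L=\bigcup_{u\in K,\,v\in L} u \sqcup\!\sqcup v$. *)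

theory Defs
  imports Main
begin

record ('q, 'a) dfa =
  states :: "'q set"
  init :: 'q
  final :: "'q set"
  delta :: "'q \<Rightarrow> 'a \<Rightarrow> 'q"

text \<open>The transition function is total on \<open>states A \<times> \<Sigma>\<close>;
  its values elsewhere are irrelevant.\<close>

definition complete_dfa :: "'a set \<Rightarrow> ('q, 'a) dfa \<Rightarrow> bool" where
  "complete_dfa \<Sigma> A \<longleftrightarrow>
     finite (states A) \<and> init A \<in> states A \<and> final A \<subseteq> states A \<and>
     (\<forall>q\<in>states A. \<forall>a\<in>\<Sigma>. delta A q a \<in> states A)"

definition dfa_lang :: "'a set \<Rightarrow> ('q, 'a) dfa \<Rightarrow> 'a list set" where
  "dfa_lang \<Sigma> A = {w \<in> lists \<Sigma>. foldl (delta A) (init A) w \<in> final A}"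

text \<open>Taking states in \<^typ>\<open>nat\<close> loses no generality, see \<open>dfa_nat_states\<close> below.\<close>

definition regular_over :: "'a set \<Rightarrow> 'a list set \<Rightarrow> bool" where
  "regular_over \<Sigma> L \<longleftrightarrow>
     (\<exists>A :: (nat, 'a) dfa. complete_dfa \<Sigma> A \<and> dfa_lang \<Sigma> A = L)"

text \<open>Only meaningful for languages that are regular over \<open>\<Sigma>\<close>; otherwise the
  \<open>LEAST\<close> ranges over the empty set and its value is unspecified.\<close>

definition state_complexity :: "'a set \<Rightarrow> 'a list set \<Rightarrow> nat" where
  "state_complexity \<Sigma> L =
     (LEAST k. \<exists>A :: (nat, 'a) dfa.
        complete_dfa \<Sigma> A \<and> dfa_lang \<Sigma> A = L \<and> card (states A) = k)"

definition shuffle_lang :: "'a list set \<Rightarrow> 'a list set \<Rightarrow> 'a list set" where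
  "shuffle_lang K L = (\<Union>u\<in>K. \<Union>v\<in>L. shuffles u v)"

definition shuffle_bound :: "nat \<Rightarrow> nat \<Rightarrow> nat" where
  "shuffle_bound m n =
     2 ^ (m * n - 1) + 2 ^ ((m - 1) * (n - 1)) * (2 ^ (m - 1) - 1) * (2 ^ (n - 1) - 1)"

lemma dfa_nat_states:
  fixes A :: "('q, 'a) dfa"
  assumes A: "complete_dfa \<Sigma> A"
  shows "\<exists>B :: (nat, 'a) dfa.
    complete_dfa \<Sigma> B \<and> dfa_lang \<Sigma> B = dfa_lang \<Sigma> A \<and> card (states B) = card (states A)"
proof -
  have fin: "finite (states A)" and ini: "init A \<in> states A" and fs: "final A \<subseteq> states A"
    and cl: "\<And>q a. q \<in> states A \<Longrightarrow> a \<in> \<Sigma> \<Longrightarrow> delta A q a \<in> states A"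
    using A by (auto simp: complete_dfa_def)
  obtain h :: "'q \<Rightarrow> nat" where h: "inj_on h (states A)"
    using finite_imp_inj_to_nat_seg[OF fin] by blast
  define g where "g = the_inv_into (states A) h"
  have g: "g (h q) = q" if "q \<in> states A" for q
    unfolding g_def using the_inv_into_f_f[OF h that] .
  define B where "B = \<lparr>states = h ` states A, init = h (init A), final = h ` final A,
    delta = (\<lambda>q a. h (delta A (g q) a))\<rparr>"
  have B: "complete_dfa \<Sigma> B"
    using fin ini fs cl g by (auto simp: complete_dfa_def B_def)
  have run: "foldl (delta A) q w \<in> states A \<and>
      foldl (delta B) (h q) w = h (foldl (delta A) q w)"
    if "w \<in> lists \<Sigma>" "q \<in> states A" for w q
    using that
  proof (induction w arbitrary: q)
    case Nil
    then show ?case by simp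
  next
    case (Cons a w)
    then have "delta A q a \<in> states A" "w \<in> lists \<Sigma>"
      by (auto intro: cl)
    moreover have "delta B (h q) a = h (delta A q a)"
      using Cons.prems g by (simp add: B_def)
    ultimately show ?case
      using Cons.IH by simp
  qed
  have "dfa_lang \<Sigma> B = dfa_lang \<Sigma> A"
  proof -
    have "foldl (delta B) (init B) w \<in> final B \<longleftrightarrow> foldl (delta A) (init A) w \<in> final A"
      if "w \<in> lists \<Sigma>" for w
    proof -
      have "foldl (delta A) (init A) w \<in> states A"
        "foldl (delta B) (init B) w = h (foldl (delta A) (init A) w)"
        using run[OF that ini] by (auto simp: B_def)
      moreover have "final B = h ` final A"
        by (simp add: B_def)
      ultimately show ?thesis
        using inj_on_image_mem_iff[OF h _ fs] by simp
    qed
    then show ?thesis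
      by (auto simp: dfa_lang_def)
  qed
  moreover have "card (states B) = card (states A)"
    using card_image[OF h] by (simp add: B_def)
  ultimately show ?thesis
    using B by blast
qed

text \<open>\<^const>\<open>shuffles\<close> is defined by recursion on both words; it agrees with the
  definition through factorizations \<open>u = u\<^sub>1\<dots>u\<^sub>k\<close>, \<open>v = v\<^sub>1\<dots>v\<^sub>k\<close>.\<close>

lemma append_append_in_shuffles:
  assumes "w \<in> shuffles u v"
  shows "a @ b @ w \<in> shuffles (a @ u) (b @ v)"
proof -
  have "b @ w \<in> shuffles u (b @ v)"
    using assms by (induction b) (auto intro: Cons_in_shuffles_rightI)
  then show ?thesis
    by (induction a) (auto intro: Cons_in_shuffles_leftI)
qed

lemma shuffles_eq_factorizations:
  "shuffles u v = {concat (map2 (@) us vs) | us vs.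
     length us = length vs \<and> u = concat us \<and> v = concat vs}"
proof (intro set_eqI iffI)
  fix w
  assume "w \<in> shuffles u v"
  then have "\<exists>us vs. w = concat (map2 (@) us vs) \<and>
      length us = length vs \<and> u = concat us \<and> v = concat vs"
  proof (induction u v arbitrary: w rule: shuffles.induct)
    case (1 ys)
    then show ?case
      by (intro exI[of _ "[[]]"] exI[of _ "[ys]"]) simp
  next
    case (2 xs)
    then show ?case
      by (intro exI[of _ "[xs]"] exI[of _ "[[]]"]) simp
  next
    case (3 x xs y ys)
    from "3.prems" consider
      w' where "w = x # w'" "w' \<in> shuffles xs (y # ys)"
      | w' where "w = y # w'" "w' \<in> shuffles (x # xs) ys"
      by auto
    then show ?case
    proof cases
      case 1
      with "3.IH"(1) obtain us vs where "w' = concat (map2 (@) us vs)"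
        "length us = length vs" "xs = concat us" "y # ys = concat vs"
        by blast
      with 1 show ?thesis
        by (intro exI[of _ "[x] # us"] exI[of _ "[] # vs"]) simp
    next
      case 2
      with "3.IH"(2) obtain us vs where "w' = concat (map2 (@) us vs)"
        "length us = length vs" "x # xs = concat us" "ys = concat vs"
        by blast
      with 2 show ?thesis
        by (intro exI[of _ "[] # us"] exI[of _ "[y] # vs"]) simp
    qed
  qed
  then show "w \<in> {concat (map2 (@) us vs) | us vs.
      length us = length vs \<and> u = concat us \<and> v = concat vs}"
    by blast
next
  fix w
  assume "w \<in> {concat (map2 (@) us vs) | us vs.
    length us = length vs \<and> u = concat us \<and> v = concat vs}"
  then obtain us vs where "w = concat (map2 (@) us vs)" "length us = length vs"
    "u = concat us" "v = concat vs"
    by blast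
  moreover have "concat (map2 (@) us vs) \<in> shuffles (concat us) (concat vs)"
    if "length us = length vs"
    using that
    by (induction us vs rule: list_induct2) (auto dest: append_append_in_shuffles)
  ultimately show "w \<in> shuffles u v"
    by simp
qed

end

theory Submission
  imports Defs "HOL-Library.FuncSet"
begin

text \<open>Give both automata all transformations as letters. The states of the subset automaton for the
  shuffle are then relations \<open>T\<close> between the two state sets, a letter inducing \<open>(s, t)\<close> sends \<open>T\<close> to
  \<open>sT \<union> tT\<close>, and the bound counts the relations that meet row \<open>0\<close> and column \<open>0\<close>. Two letters single
  out any pair \<open>(p, q)\<close>, so the point is that all these relations are reachable, which goes by
  induction on \<open>card T\<close>: we look for a smaller predecessor with the same nonempty rows and columns.

  If column \<open>j\<close> is contained in column \<open>k\<close>, then \<open>T\<close> arises by adding \<open>j\<close> to \<open>k\<close>, so the columns, and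
  likewise the rows, may be assumed to form antichains. This leaves finitely many relations with at
  most 5 rows. A row with one element, or one missing a single column, splits off together with
  a column. For every relation without such rows and columns there is a pair \<open>\<phi> = (\<sigma>, \<tau>)\<close> of
  permutations such that each \<open>x \<in> T\<close> has \<open>\<phi> x \<in> T\<close> or \<open>\<phi>\<^sup>-\<^sup>1 x \<in> T\<close>; then
  \<open>T' = T \<inter> \<phi>\<^sup>-\<^sup>1 T\<close> satisfies \<open>T = T' \<union> \<phi> T'\<close>, so that \<open>\<tau> T'\<close> is a predecessor. The pairs \<open>\<phi>\<close> are
  found by a search over antichains up to symmetry, which is run by a verified checker.\<close>

subsection \<open>Shrinkable relations\<close>

definition step :: "('a \<Rightarrow> 'a) \<Rightarrow> ('b \<Rightarrow> 'b) \<Rightarrow> ('a \<times> 'b) set \<Rightarrow> ('a \<times> 'b) set" where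
  "step s t S = map_prod s id ` S \<union> map_prod id t ` S"

text \<open>Keeping the nonempty rows and columns keeps row 0 and column 0 occupied in the
  induction. Here \<open>s\<close> and \<open>t\<close> are arbitrary functions on the types, but
  \<open>step s t S = T\<close> makes them map \<open>Domain T\<close> and \<open>Range T\<close>
  into themselves, so they can later be cut down to transformations of the state sets.\<close>

definition shrinkable :: "('a \<times> 'b) set \<Rightarrow> bool" where
  "shrinkable T \<longleftrightarrow> (\<exists>s t S. card S < card T \<and> Domain S = Domain T \<and> Range S = Range T \<and> step s t S = T)"

lemma step_iff:
  "(x, y) \<in> step s t S \<longleftrightarrow> (\<exists>p. (p, y) \<in> S \<and> s p = x) \<or> (\<exists>q. (x, q) \<in> S \<and> t q = y)"
  by (force simp: step_def)

lemma step_converse: "(step s t S)\<inverse> = step t s (S\<inverse>)"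
  by (auto simp: step_iff)

lemma shrinkable_converse:
  assumes "shrinkable (T\<inverse>)"
  shows "shrinkable T"
proof -
  obtain s t S where S: "card S < card (T\<inverse>)" "Domain S = Domain (T\<inverse>)" "Range S = Range (T\<inverse>)" "step s t S = T\<inverse>"
    using assms unfolding shrinkable_def by blast
  have "card (S\<inverse>) < card T" "Domain (S\<inverse>) = Domain T" "Range (S\<inverse>) = Range T"
    using S(1-3) by auto
  moreover have "step t s (S\<inverse>) = T"
    using S(4) by (metis converse_converse step_converse)
  ultimately show ?thesis
    unfolding shrinkable_def by blast
qed

lemma Domain_map_prod: "Domain (map_prod f h ` S) = f ` Domain S"
  and Range_map_prod: "Range (map_prod f h ` S) = h ` Range S"
  by (auto simp: Domain_fst Range_snd image_image)

text \<open>Conjugating \<open>s\<close> and \<open>t\<close> by the relabelling carries a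
  predecessor of the image back to one of \<open>T\<close>. This allows passing to standard
  coordinates, with numbered rows and with bit vectors as columns.\<close>

lemma shrinkable_isomorphic:
  fixes T :: "('a \<times> 'b) set" and f :: "'a \<Rightarrow> 'c" and h :: "'b \<Rightarrow> 'd"
  assumes f: "inj_on f (Domain T)" and h: "inj_on h (Range T)"
    and shr: "shrinkable (map_prod f h ` T)"
  shows "shrinkable T"
proof -
  let ?f = "inv_into (Domain T) f" and ?h = "inv_into (Range T) h"
  obtain s t S where S: "card S < card (map_prod f h ` T)" "Domain S = f ` Domain T" "Range S = h ` Range T"
      and st: "step s t S = map_prod f h ` T"
    using shr unfolding shrinkable_def Domain_map_prod Range_map_prod by (elim exE conjE) (rule that)
  define S' where "S' = map_prod ?f ?h ` S"
  define s' where "s' = ?f \<circ> s \<circ> f"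
  define t' where "t' = ?h \<circ> t \<circ> h"
  have inv: "inj_on (map_prod f h) T"
  proof (rule inj_onI)
    fix x y assume "x \<in> T" "y \<in> T" "map_prod f h x = map_prod f h y"
    then show "x = y"
      using inj_onD[OF f, of "fst x" "fst y"] inj_onD[OF h, of "snd x" "snd y"]
      by (cases x; cases y) (auto simp: Domain_iff Range_iff)
  qed
  have ff: "\<And>x. x \<in> f ` Domain T \<Longrightarrow> f (?f x) = x" and hh: "\<And>x. x \<in> h ` Range T \<Longrightarrow> h (?h x) = x"
    by (auto simp: f_inv_into_f)
  \<comment> \<open>Infinite sets have cardinality 0, so the strict inequality forces
    \<open>T\<close> to be finite; \<open>S\<close> then lies in the finite rectangle spanned by the
    relabelled rows and columns.\<close>
  have "finite T"
    using S(1) inv by (metis card.infinite finite_imageD not_less_zero)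
  then have finI: "finite (map_prod f h ` T)"
    by simp
  have "finite S"
  proof (rule finite_subset)
    show "S \<subseteq> f ` Domain T \<times> h ` Range T"
      by (auto simp flip: S(2,3))
    show "finite (f ` Domain T \<times> h ` Range T)"
      using \<open>finite T\<close> by (simp add: finite_Domain finite_Range)
  qed
  then have "card S' \<le> card S"
    unfolding S'_def by (rule card_image_le)
  then have 1: "card S' < card T"
    using S(1) card_image[OF inv] by simp
  have "Domain S' = ?f ` Domain S" "Range S' = ?h ` Range S"
    unfolding S'_def by (rule Domain_map_prod Range_map_prod)+
  then have 2: "Domain S' = Domain T" "Range S' = Range T"
    using S(2,3) f h by (simp_all add: inv_into_image_cancel)
  have 3: "step s' t' S' = map_prod ?f ?h ` step s t S"
  proof -
    have "map_prod s' id ` S' = map_prod ?f ?h ` map_prod s id ` S"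
      unfolding S'_def image_image
    proof (rule image_cong)
      fix x assume "x \<in> S"
      then have "fst x \<in> f ` Domain T"
        using S(2) by (metis Domain.DomainI prod.collapse)
      then show "map_prod s' id (map_prod ?f ?h x) = map_prod ?f ?h (map_prod s id x)"
        by (cases x) (simp add: s'_def ff)
    qed simp
    moreover have "map_prod id t' ` S' = map_prod ?f ?h ` map_prod id t ` S"
      unfolding S'_def image_image
    proof (rule image_cong)
      fix x assume "x \<in> S"
      then have "snd x \<in> h ` Range T"
        using S(3) by (metis Range.RangeI prod.collapse)
      then show "map_prod id t' (map_prod ?f ?h x) = map_prod ?f ?h (map_prod id t x)"
        by (cases x) (simp add: t'_def hh)
    qed simp
    ultimately show ?thesis
      by (simp add: step_def image_Un)
  qed
  have "map_prod ?f ?h ` map_prod f h ` T = T"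
  proof -
    have "map_prod ?f ?h (map_prod f h x) = x" if "x \<in> T" for x
      using that f h inv_into_f_f[OF f DomainI, of "fst x" "snd x"] inv_into_f_f[OF h RangeI, of "fst x" "snd x"]
      by (cases x) simp
    then show ?thesis
      by (force simp: image_image)
  qed
  then have "step s' t' S' = T"
    using 3 st by simp
  then show ?thesis
    using 1 2 unfolding shrinkable_def by blast
qed

text \<open>For \<open>S\<close>, the image of \<open>T'\<close> under \<open>\<tau>\<close> on
  columns, moving columns by the inverse of \<open>\<tau>\<close> returns \<open>T'\<close>, while
  moving rows by \<open>\<sigma>\<close> gives the image of \<open>T'\<close> under both maps; by
  \<open>cover\<close> the two make up \<open>T\<close>. As \<open>\<tau>\<close> permutes the
  nonempty columns, \<open>S\<close> has the same rows and columns as \<open>T\<close>.\<close>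

lemma shrinkable_by_symmetry:
  fixes \<sigma> :: "'a \<Rightarrow> 'a" and \<tau> :: "'b \<Rightarrow> 'b"
  assumes fin: "finite T" and sub: "T' \<subset> T"
    and dom: "Domain T' = Domain T" and ran: "Range T' = Range T"
    and inj: "inj_on \<tau> (Range T)" and onto: "\<tau> ` Range T = Range T"
    and cover: "T' \<union> map_prod \<sigma> \<tau> ` T' = T"
  shows "shrinkable T"
proof -
  define S where "S = map_prod id \<tau> ` T'"
  define t where "t = inv_into (Range T) \<tau>"
  have t: "t (\<tau> y) = y" if "y \<in> Range T" for y
    using that inj by (simp add: t_def inv_into_f_f)
  have "finite T'"
    using fin sub by (auto intro: finite_subset)
  then have "card S \<le> card T'"
    unfolding S_def by (rule card_image_le)
  also have "card T' < card T"
    using fin sub by (rule psubset_card_mono)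
  finally have 1: "card S < card T" .
  have "Domain S = Domain T'" "Range S = \<tau> ` Range T'"
    by (simp_all add: S_def Domain_map_prod Range_map_prod)
  then have 2: "Domain S = Domain T" "Range S = Range T"
    using dom ran onto by simp_all
  have "map_prod id t ` S = T'"
  proof -
    have "map_prod id t (map_prod id \<tau> x) = x" if "x \<in> T'" for x
      using that sub t[OF RangeI, of "fst x" "snd x"] by (cases x) auto
    then show ?thesis
      by (force simp: S_def image_image)
  qed
  moreover have "map_prod \<sigma> id ` S = map_prod \<sigma> \<tau> ` T'"
    by (simp add: S_def image_image prod.map_comp comp_def id_def flip: map_prod_def)
  ultimately have "step \<sigma> t S = T"
    using cover by (auto simp: step_def)
  then show ?thesis
    using 1 2 unfolding shrinkable_def by blast
qed

subsection \<open>A verified search through antichains\<close>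

fun below :: "bool list \<Rightarrow> bool list \<Rightarrow> bool" where
  "below (x # xs) (y # ys) = (if x \<and> \<not> y then False else below xs ys)"
| "below _ _ = True"

definition comparable :: "bool list \<Rightarrow> bool list \<Rightarrow> bool" where
  "comparable x y \<longleftrightarrow> below x y \<or> below y x"

fun has_comparable :: "bool list list \<Rightarrow> bool" where
  "has_comparable [] = False"
| "has_comparable (r # rs) = (if list_ex (comparable r) rs then True else has_comparable rs)"

definition rows :: "nat \<Rightarrow> bool list list \<Rightarrow> bool list list" where
  "rows d cs = map (\<lambda>p. map (\<lambda>c. c ! p) cs) [0..<d]"

abbreviation weight :: "bool list \<Rightarrow> nat" where
  "weight r \<equiv> length (filter id r)"

text \<open>Three reasons why no admissible set extends the node: too few columns are available;
  some row is contained in another on all available columns, so no choice separates the two; or a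
  row has so many chosen columns that it cannot miss two out of at most \<open>N\<close>.\<close>

definition prune :: "nat \<Rightarrow> nat \<Rightarrow> nat \<Rightarrow> bool list list \<Rightarrow> bool list list \<Rightarrow> bool" where
  "prune d M N ins und = (if length (ins @ und) < M then True
     else if has_comparable (rows d (ins @ und)) then True
     else list_ex (\<lambda>r. N < weight r + 2) (rows d ins))"

text \<open>A column is a subset of \<open>{..<d}\<close>, given by its characteristic vector; \<open>act g c\<close> is its preimage
  under the permutation \<open>g\<close>.\<close>

definition act :: "nat list \<Rightarrow> bool list \<Rightarrow> bool list" where
  "act g c = map ((!) c) g"

definition is_perm :: "nat \<Rightarrow> nat list \<Rightarrow> bool" where
  "is_perm d g \<longleftrightarrow> length g = d \<and> list_all (\<lambda>i. i < d) g \<and> distinct g"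

text \<open>A pair \<open>\<phi>\<close> of a row permutation \<open>g\<close> and a column permutation \<open>t\<close> is stored together with their
  inverses; in \<open>fits\<close>, the columns \<open>fs\<close>, \<open>bs\<close> and \<open>es\<close> are those of \<open>\<phi>\<^sup>-\<^sup>1 T\<close>, \<open>\<phi> T\<close> and \<open>T \<inter> \<phi>\<^sup>-\<^sup>1 T\<close>.\<close>

definition is_symmetry :: "nat \<Rightarrow> nat list \<times> nat list \<times> nat list \<times> nat list \<Rightarrow> bool" where
  "is_symmetry d = (\<lambda>(g, g', t, t'). is_perm d g \<and> is_perm d g' \<and> map ((!) g) g' = [0..<d] \<and>
     is_perm (length t) t \<and> is_perm (length t) t' \<and> map ((!) t) t' = [0..<length t])"

definition fits :: "nat \<Rightarrow> bool list list \<Rightarrow> nat list \<times> nat list \<times> nat list \<times> nat list \<Rightarrow> bool" where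
  "fits d cs = (\<lambda>(g, g', t, t').
     if length t \<noteq> length cs then False
     else let fs = map (\<lambda>k. act g (cs ! k)) t; bs = map (\<lambda>k. act g' (cs ! k)) t' in
       if \<not> list_all2 below cs (map2 (map2 (\<or>)) fs bs) then False
       else let es = map2 (map2 (\<and>)) cs fs in
         es \<noteq> cs \<and> list_all (list_ex id) es \<and> list_all (list_ex id) (rows d es))"

text \<open>The search runs over all column sets \<open>C\<close> with \<open>set ins \<subseteq> C \<subseteq> set ins \<union> set und\<close> and
  \<open>M \<le> card C \<le> N\<close>, branching on whether the first undecided column belongs to \<open>C\<close>.\<close>

function search :: "nat \<Rightarrow> nat \<Rightarrow> nat \<Rightarrow> (nat list \<times> nat list \<times> nat list \<times> nat list) list \<Rightarrow>
    bool list list \<Rightarrow> bool list list \<Rightarrow> bool" where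
  "search d M N \<phi>s ins und = (let us = if length ins = N then [] else und in
     if prune d M N ins us then True
     else case us of
       [] \<Rightarrow> find (fits d ins) \<phi>s \<noteq> None
     | c # us' \<Rightarrow>
         if search d M N \<phi>s (c # ins) (filter (\<lambda>x. \<not> comparable c x) us')
         then search d M N \<phi>s ins us' else False)"
  by pat_completeness auto
termination
  by (relation "measure (\<lambda>(_, _, _, _, _, u). length u)")
    (auto simp: less_Suc_eq_le split: if_splits)

declare search.simps [simp del]

text \<open>At a node \<open>Orb gs k l\<close>, the permutations in \<open>gs\<close> stabilize the decided and the undecided columns:
  if \<open>C\<close> meets the orbit of the first undecided column \<open>c\<close>, then up to symmetry it contains \<open>c\<close>,
  and otherwise the whole orbit can be discarded.\<close>

datatype cert = Auto | Orb "nat list list" cert cert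

definition stabilizes :: "nat \<Rightarrow> nat list \<Rightarrow> bool list list \<Rightarrow> bool" where
  "stabilizes d g cs \<longleftrightarrow> is_perm d g \<and> list_all (\<lambda>x. act g x \<in> set cs) cs"

fun check :: "nat \<Rightarrow> nat \<Rightarrow> nat \<Rightarrow> (nat list \<times> nat list \<times> nat list \<times> nat list) list \<Rightarrow>
    bool list list \<Rightarrow> bool list list \<Rightarrow> cert \<Rightarrow> bool" where
  "check d M N \<phi>s ins und Auto = search d M N \<phi>s ins und"
| "check d M N \<phi>s ins [] (Orb gs k l) = False"
| "check d M N \<phi>s ins (c # us) (Orb gs k l) \<longleftrightarrow>
     list_all (\<lambda>g. stabilizes d g ins \<and> stabilizes d g (c # us)) gs \<and>
     check d M N \<phi>s (c # ins) (filter (\<lambda>x. \<not> comparable c x) us) k \<and>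
     check d M N \<phi>s ins (filter (\<lambda>x. x \<notin> set (map (\<lambda>g. act g c) gs)) us) l"

text \<open>The core case leaves only columns with at least 2 elements and at least 2 non-elements.
  The order by weight fixes the branching order to which the certificates refer.\<close>

definition candidates :: "nat \<Rightarrow> bool list list" where
  "candidates d = concat (map (\<lambda>k. filter (\<lambda>c. weight c = k) (List.n_lists d [False, True])) [2..<d - 1])"

definition incidence :: "nat \<Rightarrow> bool list set \<Rightarrow> (nat \<times> bool list) set" where
  "incidence d C = {(i, c). c \<in> C \<and> i < d \<and> c ! i}"

text \<open>The rows appear only implicitly: the condition on \<open>p\<close> and \<open>q\<close>
  says that they form an antichain. Every clause is invariant under permuting the rows, which the
  orbit nodes rely on; the restriction of the column sizes is left to
  \<open>candidates\<close>.\<close>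

definition admissible :: "nat \<Rightarrow> nat \<Rightarrow> nat \<Rightarrow> bool list set \<Rightarrow> bool" where
  "admissible d M N C \<longleftrightarrow> finite C \<and> (\<forall>c\<in>C. length c = d) \<and> M \<le> card C \<and> card C \<le> N \<and>
     (\<forall>c\<in>C. \<forall>c'\<in>C. below c c' \<longrightarrow> c = c') \<and>
     (\<forall>p<d. \<forall>q<d. p \<noteq> q \<longrightarrow> (\<exists>c\<in>C. c ! p \<and> \<not> c ! q)) \<and>
     (\<forall>p<d. 2 \<le> card {c \<in> C. \<not> c ! p})"

section \<open>Soundness of the pruning, the symmetry test and the search\<close>

lemma below_iff:
  "length x = length y \<Longrightarrow> below x y \<longleftrightarrow> (\<forall>i<length x. x ! i \<longrightarrow> y ! i)"
proof (induction x y rule: list_induct2)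
  case (Cons x xs y ys)
  then show ?case
    by (simp add: All_less_Suc2)
qed simp

lemma below_refl: "below x x"
  by (simp add: below_iff)

lemma rows_nth: "p < d \<Longrightarrow> rows d cs ! p = map (\<lambda>c. c ! p) cs"
  by (simp add: rows_def)

lemma length_rows: "length (rows d cs) = d"
  by (simp add: rows_def)

lemma has_comparable_imp:
  "has_comparable rs \<Longrightarrow> \<exists>i j. i < length rs \<and> j < length rs \<and> i \<noteq> j \<and> below (rs ! i) (rs ! j)"
proof (induction rs)
  case (Cons r rs)
  show ?case
  proof (cases "list_ex (comparable r) rs")
    case True
    then obtain j where "j < length rs" "comparable r (rs ! j)"
      by (auto simp: list_ex_iff in_set_conv_nth)
    then consider "below ((r # rs) ! 0) ((r # rs) ! Suc j)" | "below ((r # rs) ! Suc j) ((r # rs) ! 0)"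
      by (auto simp: comparable_def)
    then show ?thesis
      using \<open>j < length rs\<close> by cases (metis Suc_less_eq length_Cons nat.distinct(1) zero_less_Suc)+
  next
    case False
    with Cons obtain i j where "i < length rs" "j < length rs" "i \<noteq> j" "below (rs ! i) (rs ! j)"
      by auto
    then show ?thesis
      by (intro exI[of _ "Suc i"] exI[of _ "Suc j"]) simp
  qed
qed simp

lemma weight_row: "weight (map (\<lambda>c. c ! p) cs) = length (filter (\<lambda>c. c ! p) cs)"
  by (induction cs) auto

lemma prune_sound:
  assumes prune: "prune d M N ins und" and adm: "admissible d M N C"
    and ins: "set ins \<subseteq> C" and und: "C \<subseteq> set ins \<union> set und" and dist: "distinct ins"
  shows False
proof -
  have fin: "finite C"
    using adm by (simp add: admissible_def)
  consider "length (ins @ und) < M" | "has_comparable (rows d (ins @ und))"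
    | p where "p < d" "N < weight (map (\<lambda>c. c ! p) ins) + 2"
    using prune by (fastforce simp: prune_def Let_def list_ex_iff rows_def split: if_splits)
  then show False
  proof cases
    case 1
    have "card C \<le> card (set (ins @ und))"
      using und by (intro card_mono) auto
    also have "\<dots> \<le> length (ins @ und)"
      by (rule card_length)
    finally show False
      using 1 adm by (simp add: admissible_def)
  next
    case 2
    then obtain p q where pq: "p < d" "q < d" "p \<noteq> q"
      and le: "below (rows d (ins @ und) ! p) (rows d (ins @ und) ! q)"
      by (auto dest!: has_comparable_imp simp: length_rows)
    then have "\<forall>i<length (ins @ und). (ins @ und) ! i ! p \<longrightarrow> (ins @ und) ! i ! q"
      by (simp add: rows_nth below_iff del: map_append)
    then have "\<forall>c\<in>set (ins @ und). c ! p \<longrightarrow> c ! q"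
      by (metis in_set_conv_nth)
    moreover obtain c where "c \<in> C" "c ! p" "\<not> c ! q"
      using adm pq unfolding admissible_def by blast
    ultimately show False
      using und by auto
  next
    case (3 p)
    have "length (filter (\<lambda>c. c ! p) ins) = card (set (filter (\<lambda>c. c ! p) ins))"
      by (rule distinct_card[OF distinct_filter[OF dist], symmetric])
    also have "\<dots> \<le> card {c \<in> C. c ! p}"
      using ins fin by (intro card_mono) auto
    finally have "N < card {c \<in> C. c ! p} + 2"
      using 3(2) unfolding weight_row by simp
    also have "\<dots> \<le> card {c \<in> C. c ! p} + card {c \<in> C. \<not> c ! p}"
      using adm 3(1) by (simp add: admissible_def)
    also have "\<dots> = card ({c \<in> C. c ! p} \<union> {c \<in> C. \<not> c ! p})"
      using fin by (subst card_Un_disjoint) auto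
    also have "{c \<in> C. c ! p} \<union> {c \<in> C. \<not> c ! p} = C"
      by auto
    finally show False
      using adm by (simp add: admissible_def)
  qed
qed

lemma is_perm_bij_betw: "is_perm d g \<Longrightarrow> bij_betw ((!) g) {..<d} {..<d}"
proof -
  assume g: "is_perm d g"
  have "inj_on ((!) g) {..<d}"
    using g by (auto simp: is_perm_def inj_on_def nth_eq_iff_index_eq)
  moreover have "(!) g ` {..<d} \<subseteq> {..<d}"
    using g by (auto simp: is_perm_def list_all_iff)
  ultimately show ?thesis
    by (simp add: bij_betw_def endo_inj_surj)
qed

lemma length_act [simp]: "length (act g c) = length g"
  by (simp add: act_def)

text \<open>Indexing the columns by their position in \<open>cs\<close> turns \<phi> into a pair of
  index permutations, and the tests in \<open>fits\<close> become the hypotheses of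
  \<open>shrinkable_by_symmetry\<close>.\<close>

lemma fits_sound:
  assumes sym: "is_symmetry d \<phi>" and fits: "fits d cs \<phi>"
    and dist: "distinct cs" and len: "\<forall>c\<in>set cs. length c = d"
  shows "shrinkable (incidence d (set cs))"
proof -
  obtain g g' t t' where \<phi>: "\<phi> = (g, g', t, t')"
    by (cases \<phi>)
  define n where "n = length cs"
  define T where "T = {(i, k). i < d \<and> k < n \<and> cs ! k ! i}"
  define T' where "T' = {(i, k). (i, k) \<in> T \<and> (g ! i, t ! k) \<in> T}"
  have g: "is_perm d g" "is_perm d g'" "map ((!) g) g' = [0..<d]"
    and t: "is_perm n t" "is_perm n t'" "map ((!) t) t' = [0..<n]"
    using sym fits by (auto simp: is_symmetry_def fits_def \<phi> n_def split: if_splits)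
  have lt: "length g = d" "length g' = d" "length t = n" "length t' = n" "length cs = n"
    using g t by (auto simp: is_perm_def n_def)
  have glt: "g ! i < d" "g' ! i < d" if "i < d" for i
    using g that by (auto simp: is_perm_def list_all_length)
  have tlt: "t ! k < n" "t' ! k < n" if "k < n" for k
    using t that by (auto simp: is_perm_def list_all_length)
  have gg': "g ! (g' ! i) = i" if "i < d" for i
    using arg_cong[OF g(3), of "\<lambda>l. l ! i"] that lt by simp
  have tt': "t ! (t' ! k) = k" if "k < n" for k
    using arg_cong[OF t(3), of "\<lambda>l. l ! k"] that lt by simp
  have lc: "length (cs ! k) = d" if "k < n" for k
    using len that lt by auto
  define fs where "fs = map (\<lambda>k. act g (cs ! k)) t"
  define bs where "bs = map (\<lambda>k. act g' (cs ! k)) t'"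
  define es where "es = map2 (map2 (\<and>)) cs fs"
  have f: "fs ! k ! i = cs ! (t ! k) ! (g ! i)" if "i < d" "k < n" for i k
    using that lt by (simp add: fs_def act_def)
  have b: "bs ! k ! i = cs ! (t' ! k) ! (g' ! i)" if "i < d" "k < n" for i k
    using that lt by (simp add: bs_def act_def)
  have lfb: "length fs = n" "length bs = n" "length es = n"
    "\<And>k. k < n \<Longrightarrow> length (fs ! k) = d" "\<And>k. k < n \<Longrightarrow> length (bs ! k) = d"
    by (simp_all add: fs_def bs_def es_def lt)
  have li: "length (es ! k) = d" if "k < n" for k
    using that by (simp add: es_def lfb lt lc)
  have es: "es ! k ! i \<longleftrightarrow> (i, k) \<in> T'" if "i < d" "k < n" for i k
    using that by (auto simp: es_def lfb lt lc f T'_def T_def glt tlt)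
  \<comment> \<open>Column \<open>k\<close> lies in the union of the \<open>k\<close>-th columns of
    \<phi>^-1 T and \<phi> T: every point of \<open>T\<close> has its image or its preimage under
    \<phi> in \<open>T\<close>.\<close>
  have cover: "cs ! k ! i \<Longrightarrow> cs ! (t ! k) ! (g ! i) \<or> cs ! (t' ! k) ! (g' ! i)"
    if "i < d" "k < n" for i k
  proof -
    have "list_all2 below cs (map2 (map2 (\<or>)) fs bs)"
      using fits by (auto simp: fits_def \<phi> fs_def bs_def Let_def split: if_splits)
    then have "below (cs ! k) (map2 (\<or>) (fs ! k) (bs ! k))"
      using that lfb lt by (auto simp: list_all2_conv_all_nth)
    then show "cs ! k ! i \<Longrightarrow> cs ! (t ! k) ! (g ! i) \<or> cs ! (t' ! k) ! (g' ! i)"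
      using that f b by (auto simp: below_iff lfb lc)
  qed
  have rest: "es \<noteq> cs" "list_all (list_ex id) es" "list_all (list_ex id) (rows d es)"
    using fits by (auto simp: fits_def \<phi> es_def fs_def Let_def split: if_splits)
  have T: "T \<subseteq> {..<d} \<times> {..<n}"
    by (auto simp: T_def)
  have T'T: "T' \<subseteq> T"
    by (auto simp: T'_def)
  have "T' \<noteq> T"
  proof
    assume "T' = T"
    then have "es = cs"
      by (intro nth_equalityI) (auto simp: lfb lt lc li es T_def)
    with rest(1) show False ..
  qed
  have ran: "k \<in> Range T'" if "k < n" for k
  proof -
    have "list_ex id (es ! k)"
      using rest(2) that lfb by (auto simp: list_all_length)
    then obtain i where "i < d" "es ! k ! i"
      using li[OF \<open>k < n\<close>] by (auto simp: list_ex_length)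
    then show ?thesis
      using es that by blast
  qed
  have dom: "i \<in> Domain T'" if "i < d" for i
  proof -
    have "list_ex id (map (\<lambda>c. c ! i) es)"
      using rest(3) that by (auto simp: list_all_length length_rows rows_nth)
    then obtain k where "k < n" "es ! k ! i"
      by (auto simp: list_ex_length lfb)
    then show ?thesis
      using es that by blast
  qed
  have D: "Domain T' = {..<d}" "Domain T = {..<d}"
    using dom Domain_mono[OF T'T] Domain_mono[OF T] by auto
  have R: "Range T' = {..<n}" "Range T = {..<n}"
    using ran Range_mono[OF T'T] Range_mono[OF T] by auto
  have tb: "bij_betw ((!) t) {..<n} {..<n}"
    using t(1) by (rule is_perm_bij_betw)
  have "shrinkable T"
  proof (rule shrinkable_by_symmetry)
    show "finite T"
      using T by (rule finite_subset) simp
    show "T' \<subset> T"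
      using T'T \<open>T' \<noteq> T\<close> by auto
    show "Domain T' = Domain T" "Range T' = Range T"
      by (simp_all add: D R)
    show "inj_on ((!) t) (Range T)" "(!) t ` Range T = Range T"
      using tb by (auto simp: R bij_betw_def)
    show "T' \<union> map_prod ((!) g) ((!) t) ` T' = T"
    proof (intro subset_antisym subsetI)
      fix x assume "x \<in> T' \<union> map_prod ((!) g) ((!) t) ` T'"
      then show "x \<in> T"
        by (auto simp: T'_def)
    next
      fix x assume x: "x \<in> T"
      obtain i k where ik: "x = (i, k)"
        by (cases x)
      have lt': "i < d" "k < n" "cs ! k ! i"
        using x by (auto simp: ik T_def)
      from cover[OF this] show "x \<in> T' \<union> map_prod ((!) g) ((!) t) ` T'"
      proof
        assume "cs ! (t ! k) ! (g ! i)"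
        then show ?thesis
          using lt' glt tlt by (auto simp: ik T'_def T_def)
      next
        \<comment> \<open>Here \<phi>^-1 x is in \<open>T\<close>. It belongs to \<open>T'\<close>
          because its image x is in \<open>T\<close>, so x lies in \<phi> T'.\<close>
        assume "cs ! (t' ! k) ! (g' ! i)"
        then have "(g' ! i, t' ! k) \<in> T'"
          using lt' glt tlt gg' tt' by (auto simp: T'_def T_def)
        moreover have "x = map_prod ((!) g) ((!) t) (g' ! i, t' ! k)"
          using lt' gg' tt' by (simp add: ik)
        ultimately show ?thesis
          by blast
      qed
    qed
  qed
  moreover have "incidence d (set cs) = map_prod id ((!) cs) ` T"
    by (force simp: incidence_def T_def in_set_conv_nth lt)
  ultimately have "shrinkable (map_prod id (inv_into {..<n} ((!) cs)) ` incidence d (set cs))"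
  proof -
    have "inj_on ((!) cs) {..<n}"
      using dist lt by (auto simp: inj_on_def nth_eq_iff_index_eq)
    then have "map_prod id (inv_into {..<n} ((!) cs)) (map_prod id ((!) cs) x) = x" if "x \<in> T" for x
      using that by (cases x) (auto simp: T_def inv_into_f_f)
    then have "map_prod id (inv_into {..<n} ((!) cs)) ` map_prod id ((!) cs) ` T = T"
      by (force simp: image_image)
    then show ?thesis
      using \<open>shrinkable T\<close> \<open>incidence d (set cs) = _\<close> by simp
  qed
  then show ?thesis
  proof (rule shrinkable_isomorphic[rotated 2])
    show "inj_on (inv_into {..<n} ((!) cs)) (Range (incidence d (set cs)))"
      by (rule inj_on_inv_into) (auto simp: incidence_def in_set_conv_nth lt)
  qed simp
qed

text \<open>Every branch keeps \<open>C\<close> between the decided and the available columns.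
  Dropping the columns comparable to a chosen one loses nothing, since \<open>C\<close> is an
  antichain; at a leaf \<open>C = set ins\<close> and a listed symmetry fits.\<close>

lemma search_sound:
  assumes "search d M N \<phi>s ins und" and "list_all (is_symmetry d) \<phi>s"
    and "admissible d M N C" "set ins \<subseteq> C" "C \<subseteq> set ins \<union> set und"
    and "distinct ins" "set ins \<inter> set und = {}"
  shows "shrinkable (incidence d C)"
  using assms
proof (induction d M N \<phi>s ins und rule: search.induct)
  case (1 d M N \<phi>s ins und)
  have fin: "finite C"
    using 1(5) by (simp add: admissible_def)
  \<comment> \<open>Once \<open>N\<close> columns are chosen, the bound on \<open>card C\<close>
    forces \<open>C = set ins\<close>, so the undecided columns can be ignored.\<close>
  define us where "us = (if length ins = N then [] else und)"
  have C: "C \<subseteq> set ins \<union> set us"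
  proof (cases "length ins = N")
    case True
    then have "card C \<le> card (set ins)"
      using 1 by (simp add: admissible_def distinct_card)
    then have "set ins = C"
      using 1(6) fin by (intro card_seteq) auto
    then show ?thesis
      by simp
  qed (use 1 us_def in auto)
  have np: "\<not> prune d M N ins us"
    using prune_sound 1 C by blast
  show ?case
  proof (cases us)
    case Nil
    then have "find (fits d ins) \<phi>s \<noteq> None"
      using 1(3) np by (subst (asm) search.simps) (auto simp: us_def[symmetric] Let_def)
    then obtain \<phi> where "\<phi> \<in> set \<phi>s" "fits d ins \<phi>"
      unfolding find_None_iff by blast
    moreover have "C = set ins"
      using C Nil 1(6) by auto
    ultimately show ?thesis
      using 1(4,5,8) by (auto intro!: fits_sound simp: list_all_iff admissible_def)
  next
    case (Cons c us')
    then have und: "us = und"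
      by (auto simp: us_def split: if_splits)
    have both: "search d M N \<phi>s (c # ins) (filter (\<lambda>x. \<not> comparable c x) us')" "search d M N \<phi>s ins us'"
      using 1(3) np Cons by (subst (asm) search.simps; auto simp: us_def[symmetric] Let_def split: if_splits)+
    show ?thesis
    proof (cases "c \<in> C")
      case True
      have "x = c" if "x \<in> C" "comparable c x" for x
        using 1(5) that True by (auto simp: admissible_def comparable_def)
      then have "C \<subseteq> set (c # ins) \<union> set (filter (\<lambda>x. \<not> comparable c x) us')"
        using C Cons by auto
      then show ?thesis
        using 1(4-9) both(1) np Cons True und us_def
        by (intro 1(1)[OF us_def np Cons]) (auto simp: comparable_def below_refl)
    next
      case False
      then show ?thesis
        using 1(4-9) both np Cons C und us_def
        by (intro 1(2)[OF us_def np Cons]) auto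
    qed
  qed
qed

lemma act_inj:
  assumes "is_perm d g" "length x = d" "length y = d" "act g x = act g y"
  shows "x = y"
proof (rule nth_equalityI)
  fix i assume "i < length x"
  then have "i \<in> (!) g ` {..<d}"
    using is_perm_bij_betw[OF assms(1)] assms(2) by (simp add: bij_betw_def)
  then obtain j where "j < d" "g ! j = i"
    by blast
  then show "x ! i = y ! i"
    using arg_cong[OF assms(4), of "\<lambda>l. l ! j"] assms(1) by (auto simp: act_def is_perm_def)
qed (use assms in simp)

lemma act_below:
  assumes "is_perm d g" "length x = d" "length y = d" "below x y"
  shows "below (act g x) (act g y)"
  using assms by (auto simp: below_iff act_def is_perm_def list_all_length)

text \<open>\<open>act g\<close> is invertible on vectors of length \<open>d\<close>, so it maps
  \<open>C'\<close> bijectively onto \<open>C\<close> and the incidence relations differ only by a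
  relabelling. At an orbit node this replaces a column set by a symmetric one.\<close>

lemma admissible_act:
  assumes g: "is_perm d g" and adm: "admissible d M N C"
  defines "C' \<equiv> {x. length x = d \<and> act g x \<in> C}"
  shows "admissible d M N C'" and "shrinkable (incidence d C') \<Longrightarrow> shrinkable (incidence d C)"
proof -
  have lg: "length g = d"
    using g by (simp add: is_perm_def)
  have bij: "bij_betw ((!) g) {..<d} {..<d}"
    using g by (rule is_perm_bij_betw)
  have ex: "\<exists>j<d. g ! j = p" if "p < d" for p
  proof -
    have "p \<in> (!) g ` {..<d}"
      using bij that by (simp add: bij_betw_def)
    then show ?thesis
      by auto
  qed
  have act_nth: "act g x ! j = x ! (g ! j)" if "j < d" for x j
    using that lg by (simp add: act_def)
  have lenC: "length c = d" if "c \<in> C" for c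
    using adm that by (simp add: admissible_def)
  have inj: "inj_on (act g) C'"
    by (rule inj_onI) (auto simp: C'_def intro: act_inj[OF g])
  have onto: "act g ` C' = C"
  proof (intro subset_antisym subsetI)
    fix y assume y: "y \<in> C"
    define x where "x = map (\<lambda>i. y ! inv_into {..<d} ((!) g) i) [0..<d]"
    have "act g x = y"
    proof (rule nth_equalityI)
      show "length (act g x) = length y"
        using y lenC lg by simp
      fix j assume "j < length (act g x)"
      then have j: "j < d"
        by (simp add: lg)
      then have "g ! j < d"
        using bij by (auto simp: bij_betw_def)
      then show "act g x ! j = y ! j"
        using j bij by (simp add: act_nth x_def bij_betw_def inv_into_f_f)
    qed
    then show "y \<in> act g ` C'"
      using y by (intro image_eqI[of _ _ x]) (simp_all add: C'_def x_def)
  qed (auto simp: C'_def)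
  have card_sub: "card {x \<in> C'. P (act g x)} = card {y \<in> C. P y}" for P
  proof -
    have "act g ` {x \<in> C'. P (act g x)} = {y \<in> C. P y}"
      using onto by auto
    moreover have "inj_on (act g) {x \<in> C'. P (act g x)}"
      using inj by (rule inj_on_subset) auto
    ultimately show ?thesis
      by (metis card_image)
  qed
  have "card C' = card C"
    using card_image[OF inj] by (simp add: onto)
  have "finite C'"
    using adm inj by (intro finite_imageD[of "act g" C']) (simp_all add: onto admissible_def)
  moreover have "\<forall>c\<in>C'. length c = d"
    by (simp add: C'_def)
  moreover have "M \<le> card C'" "card C' \<le> N"
    using adm \<open>card C' = card C\<close> by (simp_all add: admissible_def)
  moreover have "\<forall>c\<in>C'. \<forall>c'\<in>C'. below c c' \<longrightarrow> c = c'"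
  proof (intro ballI impI)
    fix c c' assume *: "c \<in> C'" "c' \<in> C'" "below c c'"
    then have "below (act g c) (act g c')"
      by (intro act_below[OF g]) (auto simp: C'_def)
    then have "act g c = act g c'"
      using adm * by (simp add: admissible_def C'_def)
    then show "c = c'"
      using inj * by (simp add: inj_on_eq_iff)
  qed
  moreover have "\<exists>c\<in>C'. c ! p \<and> \<not> c ! q" if pq: "p < d" "q < d" "p \<noteq> q" for p q
  proof -
    obtain j k where jk: "j < d" "g ! j = p" "k < d" "g ! k = q"
      using ex pq by metis
    then have "j \<noteq> k"
      using pq by auto
    then obtain y where "y \<in> C" "y ! j" "\<not> y ! k"
      using adm jk unfolding admissible_def by blast
    then show ?thesis
      using onto jk act_nth by auto
  qed
  moreover have "2 \<le> card {c \<in> C'. \<not> c ! p}" if p: "p < d" for p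
  proof -
    obtain j where j: "j < d" "g ! j = p"
      using ex p by blast
    have "card {c \<in> C'. \<not> c ! p} = card {c \<in> C. \<not> c ! j}"
      using card_sub[of "\<lambda>c. \<not> c ! j"] j by (simp add: act_nth)
    then show ?thesis
      using adm j by (simp add: admissible_def)
  qed
  ultimately show "admissible d M N C'"
    by (simp add: admissible_def)
  show "shrinkable (incidence d C)" if "shrinkable (incidence d C')"
  proof (rule shrinkable_isomorphic)
    show "inj_on ((!) g) (Domain (incidence d C))"
      using bij by (auto simp: bij_betw_def incidence_def intro: inj_on_subset)
    show "inj_on (inv_into C' (act g)) (Range (incidence d C))"
      by (rule inj_on_inv_into) (auto simp: onto incidence_def)
    have "map_prod ((!) g) (inv_into C' (act g)) ` incidence d C = incidence d C'"
    proof (intro subset_antisym subsetI)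
      fix z assume "z \<in> map_prod ((!) g) (inv_into C' (act g)) ` incidence d C"
      then obtain i y where z: "z = (g ! i, inv_into C' (act g) y)" "y \<in> C" "i < d" "y ! i"
        by (auto simp: incidence_def)
      obtain x where x: "x \<in> C'" "y = act g x"
        using z(2) onto by auto
      then have "inv_into C' (act g) y = x"
        using inj by simp
      moreover have "g ! i < d"
        using bij z(3) by (auto simp: bij_betw_def)
      ultimately show "z \<in> incidence d C'"
        using z x by (simp add: incidence_def act_nth)
    next
      fix z assume "z \<in> incidence d C'"
      then obtain p x where z: "z = (p, x)" "x \<in> C'" "p < d" "x ! p"
        by (auto simp: incidence_def)
      obtain j where j: "j < d" "g ! j = p"
        using ex z by blast
      have "z = map_prod ((!) g) (inv_into C' (act g)) (j, act g x)"
        using z j inj by simp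
      moreover have "(j, act g x) \<in> incidence d C"
        using z j by (auto simp: incidence_def act_nth C'_def)
      ultimately show "z \<in> map_prod ((!) g) (inv_into C' (act g)) ` incidence d C"
        by blast
    qed
    then show "shrinkable (map_prod ((!) g) (inv_into C' (act g)) ` incidence d C)"
      using that by simp
  qed
qed

lemma check_sound:
  assumes "check d M N \<phi>s ins und \<xi>" and "list_all (is_symmetry d) \<phi>s"
    and "admissible d M N C" "set ins \<subseteq> C" "C \<subseteq> set ins \<union> set und"
    and "distinct ins" "set ins \<inter> set und = {}" "\<forall>x\<in>set und. length x = d"
  shows "shrinkable (incidence d C)"
  using assms
proof (induction d M N \<phi>s ins und \<xi> arbitrary: C rule: check.induct)
  case (1 d M N \<phi>s ins und)
  then show ?case
    by (auto intro: search_sound)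
next
  case (3 d M N \<phi>s ins c us gs k l)
  note \<phi>s = "3.prems"(2)
  have lenc: "length c = d" and lenU: "\<forall>x\<in>set us. length x = d"
    using "3.prems"(8) by simp_all
  \<comment> \<open>Stated for arbitrary \<open>B\<close>, as it is applied both to \<open>C\<close>
    itself and to the preimage of \<open>C\<close> under a permutation; this is also why the
    induction generalizes \<open>C\<close>.\<close>
  have pivot: "shrinkable (incidence d B)"
    if B: "admissible d M N B" "set ins \<subseteq> B" "B \<subseteq> set ins \<union> set (c # us)" "c \<in> B" for B
  proof (rule "3.IH"(1))
    have "x = c" if "x \<in> B" "comparable c x" for x
      using B(1,4) that by (auto simp: admissible_def comparable_def)
    then show "B \<subseteq> set (c # ins) \<union> set (filter (\<lambda>x. \<not> comparable c x) us)"
      using B by auto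
  qed (use B \<phi>s "3.prems" in \<open>auto simp: comparable_def below_refl\<close>)
  show ?case
  proof (cases "c \<in> C")
    case True
    then show ?thesis
      using "3.prems" by (intro pivot) auto
  next
    case nc: False
    show ?thesis
    proof (cases "\<exists>g\<in>set gs. act g c \<in> C")
      case True
      then obtain g where g: "g \<in> set gs" "act g c \<in> C"
        by blast
      then have stab: "stabilizes d g ins" "stabilizes d g (c # us)"
        using "3.prems"(1) by (auto simp: list_all_iff)
      then have perm: "is_perm d g" and stab': "\<forall>x\<in>set ins. act g x \<in> set ins"
        "\<forall>x\<in>set (c # us). act g x \<in> set (c # us)"
        by (auto simp: stabilizes_def list_all_iff)
      define U where "U = set ins \<union> set (c # us)"
      define C' where "C' = {x. length x = d \<and> act g x \<in> C}"
      have lenU': "\<forall>x\<in>U. length x = d"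
        using "3.prems"(3,4,8) by (auto simp: U_def admissible_def)
      have "inj_on (act g) U"
        using lenU' by (auto intro!: inj_onI act_inj[OF perm])
      \<comment> \<open>\<open>stabilizes\<close> only checks that \<open>act g\<close> maps the
        decided and the undecided columns into themselves. Injectivity on the finite set
        \<open>U\<close> gives equality, so the preimage of a subset of \<open>U\<close> stays in
        \<open>U\<close>.\<close>
      then have "act g ` U = U"
        using stab' by (intro endo_inj_surj) (auto simp: U_def)
      have "C' \<subseteq> U"
      proof
        fix x assume x: "x \<in> C'"
        then have "act g x \<in> U"
          using "3.prems"(5) by (auto simp: C'_def U_def)
        then obtain u where "u \<in> U" "act g u = act g x"
          using \<open>act g ` U = U\<close> by (metis imageE)
        then show "x \<in> U"
          using x lenU' act_inj[OF perm, of u x] by (auto simp: C'_def)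
      qed
      have "shrinkable (incidence d C')"
      proof (rule pivot)
        show "admissible d M N C'"
          unfolding C'_def by (rule admissible_act(1)[OF perm "3.prems"(3)])
        show "set ins \<subseteq> C'"
          using stab' "3.prems"(4) lenU' by (auto simp: C'_def U_def)
        show "C' \<subseteq> set ins \<union> set (c # us)"
          using \<open>C' \<subseteq> U\<close> by (simp add: U_def)
        show "c \<in> C'"
          using g lenc by (simp add: C'_def)
      qed
      then show ?thesis
        unfolding C'_def by (rule admissible_act(2)[OF perm "3.prems"(3)])
    next
      case False
      show ?thesis
      proof (rule "3.IH"(2))
        show "C \<subseteq> set ins \<union> set (filter (\<lambda>x. x \<notin> set (map (\<lambda>g. act g c) gs)) us)"
          using "3.prems"(5) nc False by auto
      qed (use "3.prems" in auto)
    qed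
  qed
qed simp

subsection \<open>Search data\<close>

text \<open>The lists are ordered by a greedy covering of the leaves of the search; the orbit nodes are those
  where the plain search would visit more than 100, 200 and 50 nodes, respectively.\<close>

definition symmetries4 :: "(nat list \<times> nat list \<times> nat list \<times> nat list) list" where
  "symmetries4 = [
    ([0,1,2,3], [0,1,2,3], [1,3,0,2], [2,0,3,1]),
    ([1,2,3,0], [3,0,1,2], [1,3,2,0,4], [3,0,2,1,4]),
    ([0,1,2,3], [0,1,2,3], [0,2,4,1,3], [0,3,1,4,2]),
    ([0,1,2,3], [0,1,2,3], [0,1,2,4,5,3], [0,1,2,5,3,4])]"

definition certificate4 :: cert where
  "certificate4 =
    Auto"

definition symmetries5 :: "(nat list \<times> nat list \<times> nat list \<times> nat list) list" where
  "symmetries5 = [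
    ([0,1,3,2,4], [0,1,3,2,4], [1,3,2,0], [3,0,2,1]),
    ([1,0,2,3,4], [1,0,2,3,4], [1,3,0,2,4], [2,0,3,1,4]),
    ([1,0,2,3,4], [1,0,2,3,4], [1,2,3,0,4], [3,0,1,2,4]),
    ([0,1,3,4,2], [0,1,4,2,3], [0,1,3,2,4], [0,1,3,2,4]),
    ([4,2,3,1,0], [4,3,1,2,0], [2,3,4,0,1], [3,4,0,1,2]),
    ([0,1,2,3,4], [0,1,2,3,4], [1,2,0,3,4], [2,0,1,3,4]),
    ([1,3,0,2,4], [2,0,3,1,4], [2,0,1,3,4,5], [1,2,0,3,4,5]),
    ([0,2,3,4,1], [0,4,1,2,3], [0,1,5,2,3,4], [0,1,3,4,5,2]),
    ([0,1,2,3,4], [0,1,2,3,4], [0,1,2,4,5,3], [0,1,2,5,3,4]),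
    ([0,2,3,1,4], [0,3,1,2,4], [1,0,5,2,3,4], [1,0,3,4,5,2]),
    ([2,4,3,0,1], [3,4,0,2,1], [2,5,1,3,0,4], [4,2,0,3,5,1]),
    ([0,1,3,4,2], [0,1,4,2,3], [0,1,5,2,3,4], [0,1,3,4,5,2]),
    ([0,2,1,4,3], [0,2,1,4,3], [0,2,3,1,5,4], [0,3,1,2,5,4]),
    ([0,2,1,4,3], [0,2,1,4,3], [1,4,0,2,5,3], [2,0,3,5,1,4]),
    ([0,1,2,3,4], [0,1,2,3,4], [0,2,4,3,1,5], [0,4,1,3,2,5]),
    ([0,1,2,3,4], [0,1,2,3,4], [0,1,3,5,4,2], [0,1,5,2,4,3]),
    ([0,1,2,3,4], [0,1,2,3,4], [0,1,2,3,5,6,4], [0,1,2,3,6,4,5]),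
    ([0,1,2,3,4], [0,1,2,3,4], [0,1,2,4,6,5,3], [0,1,2,6,3,5,4]),
    ([0,2,3,4,1], [0,4,1,2,3], [1,2,0,6,3,4,5], [2,0,1,4,5,6,3]),
    ([4,1,3,2,0], [4,1,3,2,0], [1,6,4,3,5,0,2], [5,0,6,3,2,4,1]),
    ([0,1,2,3,4], [0,1,2,3,4], [0,2,5,3,1,4,6], [0,4,1,3,5,2,6]),
    ([0,1,2,3,4], [0,1,2,3,4], [0,1,2,3,4,6,7,5], [0,1,2,3,4,7,5,6]),
    ([0,1,2,3,4], [0,1,2,3,4], [0,1,2,3,5,7,6,4], [0,1,2,3,7,4,6,5]),
    ([0,1,2,3,4], [0,1,2,3,4], [0,2,6,3,4,1,5,7], [0,5,1,3,4,6,2,7]),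
    ([0,1,2,3,4], [0,1,2,3,4], [0,1,2,3,4,5,7,8,6], [0,1,2,3,4,5,8,6,7]),
    ([0,1,2,3,4], [0,1,2,3,4], [3,2,5,7,4,0,6,1,8], [5,7,1,0,4,2,6,3,8]),
    ([0,1,2,3,4], [0,1,2,3,4], [6,1,2,0,4,5,9,8,3,7], [3,1,2,8,4,5,0,9,7,6])]"

definition certificate5 :: cert where
  "certificate5 =
    Orb [[0,2,1,3,4], [0,2,3,1,4], [0,2,3,4,1], [2,0,1,3,4], [2,0,3,1,4], [2,0,3,4,1],
    [2,3,0,1,4], [2,3,0,4,1], [2,3,4,0,1]] (Orb [[0,1,3,2,4], [0,1,3,4,2], [1,0,2,3,4],
    [1,0,3,2,4], [1,0,3,4,2]] (Orb [] (Orb [[0,1,2,4,3], [1,0,2,3,4], [1,0,2,4,3], [1,2,0,3,4],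
    [1,2,0,4,3]] Auto Auto) (Orb [[0,1,2,4,3]] (Orb [[0,2,1,3,4]] Auto Auto) Auto)) (Orb
    [[0,1,2,4,3], [0,1,4,2,3]] Auto Auto)) (Orb [[0,1,3,2,4], [0,1,3,4,2], [0,3,1,2,4],
    [0,3,1,4,2], [0,3,4,1,2], [3,0,1,2,4], [3,0,1,4,2], [3,0,4,1,2], [3,4,0,1,2]] (Orb
    [[0,1,2,4,3], [0,2,1,3,4], [0,2,1,4,3], [2,0,1,3,4], [2,0,1,4,3]] (Orb [[1,0,2,3,4]] (Orb []
    Auto Auto) Auto) Auto) Auto)"

definition symmetries6 :: "(nat list \<times> nat list \<times> nat list \<times> nat list) list" where
  "symmetries6 = [
    ([0,1,2,4,5,3], [0,1,2,5,3,4], [0,1,2,3,4,5], [0,1,2,3,4,5]),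
    ([0,1,3,5,2,4], [0,1,4,2,5,3], [0,1,2,3,4,5], [0,1,2,3,4,5]),
    ([0,1,3,5,2,4], [0,1,4,2,5,3], [0,1,2,3,5,4], [0,1,2,3,5,4]),
    ([0,1,2,4,5,3], [0,1,2,5,3,4], [0,1,5,2,3,4], [0,1,3,4,5,2]),
    ([1,4,0,2,3,5], [2,0,3,4,1,5], [1,0,2,4,3,5], [1,0,2,4,3,5]),
    ([1,4,0,2,3,5], [2,0,3,4,1,5], [1,0,3,2,4,5], [1,0,3,2,4,5]),
    ([2,4,1,0,3,5], [3,2,0,4,1,5], [0,1,2,4,5,3], [0,1,2,5,3,4]),
    ([2,3,1,4,0,5], [4,2,0,1,3,5], [3,0,2,5,1,4], [1,4,2,0,5,3]),
    ([0,2,3,5,1,4], [0,4,1,2,5,3], [0,1,2,5,3,4], [0,1,2,4,5,3]),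
    ([1,2,3,4,5,0], [5,0,1,2,3,4], [0,4,1,2,3,5], [0,2,3,4,1,5]),
    ([1,2,5,0,3,4], [3,0,1,4,5,2], [2,0,1,4,3,5], [1,2,0,4,3,5]),
    ([0,3,2,5,1,4], [0,4,2,1,5,3], [0,1,3,5,2,4], [0,1,4,2,5,3]),
    ([1,0,2,4,3,5], [1,0,2,4,3,5], [1,4,0,2,3,5], [2,0,3,4,1,5]),
    ([1,4,0,5,3,2], [2,0,5,4,1,3], [2,4,0,5,1,3], [2,4,0,5,1,3]),
    ([1,5,0,2,3,4], [2,0,3,4,5,1], [2,0,3,1,4,5], [1,3,0,2,4,5]),
    ([0,2,5,1,3,4], [0,3,1,4,5,2], [0,2,1,3,5,4], [0,2,1,3,5,4]),
    ([1,0,3,4,2,5], [1,0,4,2,3,5], [1,3,0,2,4,5], [2,0,3,1,4,5]),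
    ([0,1,4,5,3,2], [0,1,5,4,2,3], [0,1,2,4,3,5], [0,1,2,4,3,5]),
    ([1,2,5,0,3,4], [3,0,1,4,5,2], [2,0,3,5,1,4], [1,4,0,2,5,3]),
    ([1,3,0,4,5,2], [2,0,5,1,3,4], [0,3,5,2,1,4], [0,4,3,1,5,2]),
    ([0,2,5,3,1,4], [0,4,1,3,5,2], [1,5,3,0,2,4], [3,0,4,2,5,1]),
    ([0,1,2,3,4,5], [0,1,2,3,4,5], [1,4,2,0,3,5], [3,0,2,4,1,5]),
    ([0,1,3,2,4,5], [0,1,3,2,4,5], [0,1,2,4,5,3], [0,1,2,5,3,4])]"

definition certificate6 :: cert where
  "certificate6 =
    Orb [[0,2,1,3,4,5], [0,2,3,1,4,5], [0,2,3,4,1,5], [0,2,3,4,5,1], [2,0,1,3,4,5], [2,0,3,1,4,5],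
    [2,0,3,4,1,5], [2,0,3,4,5,1], [2,3,0,1,4,5], [2,3,0,4,1,5], [2,3,0,4,5,1], [2,3,4,0,1,5],
    [2,3,4,0,5,1], [2,3,4,5,0,1]] (Orb [[0,1,3,2,4,5], [0,1,3,4,2,5], [0,1,3,4,5,2],
    [1,0,2,3,4,5], [1,0,3,2,4,5], [1,0,3,4,2,5], [1,0,3,4,5,2]] (Orb [] (Orb [[0,1,2,4,3,5],
    [0,1,2,4,5,3], [1,0,2,3,4,5], [1,0,2,4,3,5], [1,0,2,4,5,3], [1,2,0,3,4,5], [1,2,0,4,3,5],
    [1,2,0,4,5,3]] (Orb [[0,2,1,3,4,5]] Auto (Orb [[0,1,2,3,5,4]] Auto (Orb [[0,1,2,3,5,4],
    [0,2,1,3,4,5], [0,2,1,3,5,4]] Auto Auto))) (Orb [[0,1,2,3,5,4], [0,1,2,5,3,4]] Auto (Orb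
    [[0,1,2,3,5,4], [0,1,2,5,3,4], [1,0,2,3,4,5], [1,0,2,3,5,4], [1,0,2,5,3,4], [1,2,0,3,4,5],
    [1,2,0,3,5,4], [1,2,0,5,3,4]] Auto Auto))) (Orb [[0,1,2,4,3,5], [0,1,2,4,5,3]] (Orb
    [[0,2,1,3,4,5]] (Orb [] Auto (Orb [[0,1,2,3,5,4]] Auto (Orb [[0,1,2,3,5,4], [0,3,2,1,4,5],
    [0,3,2,1,5,4]] Auto Auto))) (Orb [[0,1,2,3,5,4]] (Orb [[0,2,1,3,4,5], [0,2,3,1,4,5]] Auto (Orb
    [] Auto (Orb [[0,2,1,3,4,5], [0,2,3,1,4,5], [0,2,3,4,1,5]] Auto (Orb [[0,1,2,4,3,5],
    [0,1,4,2,3,5], [0,4,1,2,3,5]] Auto (Orb [[0,1,3,2,4,5], [0,1,3,4,2,5], [0,3,1,2,4,5],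
    [0,3,1,4,2,5], [0,3,4,1,2,5]] Auto Auto))))) (Orb [[0,1,2,3,5,4], [0,2,1,3,4,5],
    [0,2,1,3,5,4], [0,2,3,1,4,5], [0,2,3,1,5,4]] (Orb [[0,1,3,2,4,5]] Auto (Orb [] Auto (Orb
    [[0,1,3,2,4,5]] Auto (Orb [] Auto (Orb [] Auto (Orb [] Auto Auto)))))) (Orb [] (Orb [] Auto
    (Orb [[0,1,2,3,5,4], [0,1,3,2,4,5], [0,1,3,2,5,4], [0,3,1,2,4,5], [0,3,1,2,5,4]] Auto Auto))
    (Orb [] Auto (Orb [[0,1,2,3,5,4], [0,1,3,2,4,5], [0,1,3,2,5,4], [0,3,1,2,4,5], [0,3,1,2,5,4]]
    (Orb [[0,2,1,3,4,5]] Auto (Orb [] Auto Auto)) (Orb [] Auto Auto))))))) (Orb [[0,1,2,4,3,5],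
    [0,1,2,4,5,3], [0,2,1,3,4,5], [0,2,1,4,3,5], [0,2,1,4,5,3]] (Orb [] (Orb [[0,1,2,3,5,4],
    [0,2,1,3,4,5], [0,2,1,3,5,4]] Auto Auto) (Orb [[0,1,2,3,5,4]] (Orb [] Auto (Orb [] Auto (Orb
    [] Auto (Orb [] Auto (Orb [[0,1,2,4,3,5]] Auto Auto))))) (Orb [[0,1,2,3,5,4], [1,0,3,2,4,5],
    [1,0,3,2,5,4]] (Orb [] Auto (Orb [] Auto (Orb [[0,2,1,4,3,5]] Auto Auto))) (Orb [] Auto (Orb
    [[0,1,2,3,5,4], [1,0,3,2,4,5], [1,0,3,2,5,4]] (Orb [] Auto Auto) Auto))))) (Orb
    [[0,1,2,3,5,4], [0,1,2,5,3,4]] (Orb [[0,1,2,4,3,5]] (Orb [] Auto Auto) (Orb [[0,1,2,4,3,5]]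
    (Orb [] Auto Auto) (Orb [] Auto (Orb [[0,1,2,4,3,5]] Auto Auto)))) (Orb [[0,1,2,4,3,5],
    [0,1,2,4,5,3]] (Orb [[0,1,2,3,5,4]] (Orb [] Auto (Orb [[0,2,1,3,4,5]] Auto (Orb [] Auto
    Auto))) (Orb [[0,1,2,3,5,4]] (Orb [[0,2,1,3,4,5]] Auto Auto) (Orb [[0,1,2,3,5,4],
    [0,2,1,3,4,5], [0,2,1,3,5,4]] Auto Auto))) (Orb [[0,1,2,3,5,4], [0,1,2,5,3,4]] (Orb
    [[0,2,1,3,4,5]] (Orb [] Auto (Orb [[0,1,2,4,3,5]] Auto Auto)) (Orb [[0,1,2,4,3,5]] (Orb
    [[0,2,1,3,4,5]] Auto Auto) (Orb [[0,1,2,4,3,5], [0,2,1,3,4,5], [0,2,1,4,3,5]] Auto Auto)))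
    (Orb [[0,1,2,3,5,4], [0,1,2,5,3,4], [0,2,1,3,4,5], [0,2,1,3,5,4], [0,2,1,5,3,4]] (Orb [] Auto
    (Orb [[0,1,2,4,3,5]] Auto Auto)) Auto))))))) (Orb [[0,1,2,4,3,5], [0,1,2,4,5,3],
    [0,1,4,2,3,5], [0,1,4,2,5,3], [0,1,4,5,2,3]] (Orb [[0,1,2,3,5,4], [0,1,3,2,4,5],
    [0,1,3,2,5,4]] (Orb [] (Orb [[0,1,3,2,4,5], [0,1,3,4,2,5]] Auto Auto) (Orb [] (Orb
    [[0,1,2,4,3,5]] Auto (Orb [[0,1,2,3,5,4], [0,1,2,5,3,4], [1,0,2,3,4,5], [1,0,2,3,5,4],
    [1,0,2,5,3,4]] Auto Auto)) (Orb [[0,1,2,4,3,5]] Auto (Orb [[1,0,2,3,4,5]] (Orb [] Auto Auto)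
    (Orb [[1,0,2,3,4,5]] (Orb [] Auto Auto) Auto))))) (Orb [] (Orb [[0,1,2,3,5,4], [0,1,3,2,4,5],
    [0,1,3,2,5,4], [1,0,2,3,4,5], [1,0,2,3,5,4], [1,0,3,2,4,5], [1,0,3,2,5,4]] (Orb
    [[2,3,0,1,4,5], [2,3,4,5,0,1]] Auto Auto) Auto) (Orb [[0,1,2,3,5,4], [0,1,3,2,4,5],
    [0,1,3,2,5,4], [1,0,2,3,4,5], [1,0,2,3,5,4], [1,0,3,2,4,5], [1,0,3,2,5,4]] (Orb
    [[2,3,0,1,4,5]] (Orb [[1,0,2,3,4,5]] Auto (Orb [[1,0,2,3,4,5]] Auto Auto)) (Orb [] (Orb
    [[1,0,3,2,4,5]] Auto Auto) (Orb [] (Orb [[2,3,0,1,4,5]] Auto (Orb [] Auto Auto)) (Orb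
    [[2,3,0,1,4,5]] (Orb [] Auto Auto) Auto)))) Auto))) (Orb [[0,1,2,4,3,5], [0,1,2,4,5,3],
    [0,1,4,2,3,5], [0,1,4,2,5,3], [0,1,4,5,2,3], [1,0,2,3,4,5], [1,0,2,4,3,5], [1,0,2,4,5,3],
    [1,0,4,2,3,5], [1,0,4,2,5,3], [1,0,4,5,2,3]] (Orb [] (Orb [[0,1,2,3,5,4], [0,1,3,2,4,5],
    [0,1,3,2,5,4], [1,0,2,3,4,5], [1,0,2,3,5,4], [1,0,3,2,4,5], [1,0,3,2,5,4]] (Orb [] Auto (Orb
    [] Auto (Orb [] Auto (Orb [] Auto (Orb [] Auto (Orb [] Auto Auto)))))) Auto) (Orb
    [[0,1,2,3,5,4], [0,1,3,2,4,5], [0,1,3,2,5,4]] (Orb [] (Orb [] Auto (Orb [] Auto (Orb [] Auto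
    (Orb [] Auto (Orb [] Auto (Orb [] Auto Auto)))))) (Orb [] (Orb [] Auto (Orb [] Auto (Orb
    [[0,1,3,2,4,5], [0,1,3,4,2,5]] Auto (Orb [[0,1,3,2,4,5], [0,1,3,4,2,5]] Auto Auto)))) (Orb []
    (Orb [] Auto (Orb [] Auto (Orb [] Auto (Orb [[0,1,2,4,3,5]] Auto Auto)))) (Orb [] (Orb [] Auto
    (Orb [] Auto (Orb [[0,1,2,4,3,5]] Auto Auto))) (Orb [] (Orb [] Auto (Orb [[0,1,2,4,3,5]] Auto
    (Orb [[0,1,2,4,3,5]] Auto (Orb [[0,1,2,4,3,5]] Auto Auto)))) (Orb [] (Orb [[0,1,2,4,3,5]] Auto
    (Orb [[0,1,2,4,3,5]] Auto Auto)) (Orb [[0,1,2,4,3,5]] (Orb [] Auto (Orb [] Auto Auto)) (Orb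
    [[0,1,2,4,3,5]] Auto (Orb [[0,1,2,4,3,5]] Auto Auto))))))))) (Orb [[0,1,2,3,5,4],
    [0,1,3,2,4,5], [0,1,3,2,5,4]] (Orb [] (Orb [] Auto (Orb [[0,1,3,2,4,5]] Auto Auto)) (Orb []
    (Orb [] Auto (Orb [] Auto Auto)) (Orb [] (Orb [] Auto (Orb [] Auto Auto)) (Orb [] Auto (Orb []
    Auto (Orb [] Auto Auto)))))) (Orb [[0,1,2,3,5,4]] (Orb [] Auto (Orb [] Auto (Orb [] Auto
    Auto))) (Orb [] Auto (Orb [] Auto Auto)))))) (Orb [[0,1,2,3,5,4], [0,1,2,5,3,4],
    [0,1,5,2,3,4]] (Orb [[0,1,2,4,3,5], [0,1,4,2,3,5]] Auto (Orb [[0,1,2,4,3,5], [0,1,4,2,3,5],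
    [1,0,2,3,4,5], [1,0,2,4,3,5], [1,0,4,2,3,5]] Auto Auto)) (Orb [[0,1,2,3,5,4], [0,1,2,5,3,4],
    [0,1,5,2,3,4], [1,0,2,3,4,5], [1,0,2,3,5,4], [1,0,2,5,3,4], [1,0,5,2,3,4]] (Orb [] Auto (Orb
    [[0,1,2,4,3,5], [0,1,4,2,3,5]] Auto Auto)) Auto))))) (Orb [[0,1,3,2,4,5], [0,1,3,4,2,5],
    [0,1,3,4,5,2], [0,3,1,2,4,5], [0,3,1,4,2,5], [0,3,1,4,5,2], [0,3,4,1,2,5], [0,3,4,1,5,2],
    [0,3,4,5,1,2], [3,0,1,2,4,5], [3,0,1,4,2,5], [3,0,1,4,5,2], [3,0,4,1,2,5], [3,0,4,1,5,2],
    [3,0,4,5,1,2], [3,4,0,1,2,5], [3,4,0,1,5,2], [3,4,0,5,1,2], [3,4,5,0,1,2]] (Orb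
    [[0,1,2,4,3,5], [0,1,2,4,5,3], [0,2,1,3,4,5], [0,2,1,4,3,5], [0,2,1,4,5,3], [2,0,1,3,4,5],
    [2,0,1,4,3,5], [2,0,1,4,5,3]] (Orb [[1,0,2,3,4,5]] (Orb [] (Orb [[0,1,2,3,5,4], [0,2,1,3,4,5],
    [0,2,1,3,5,4], [0,2,3,1,4,5], [0,2,3,1,5,4], [2,0,1,3,4,5], [2,0,1,3,5,4], [2,0,3,1,4,5],
    [2,0,3,1,5,4], [2,3,0,1,4,5], [2,3,0,1,5,4]] Auto Auto) (Orb [[0,1,2,3,5,4], [0,2,1,3,4,5],
    [0,2,1,3,5,4], [0,2,3,1,4,5], [0,2,3,1,5,4]] (Orb [[0,1,3,2,4,5]] Auto (Orb [[0,1,3,2,4,5]]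
    Auto (Orb [] Auto (Orb [] Auto (Orb [[0,1,3,2,4,5]] Auto (Orb [[0,1,3,2,4,5]] Auto (Orb []
    Auto Auto))))))) (Orb [[0,1,2,3,5,4], [0,1,3,2,4,5], [0,1,3,2,5,4], [0,3,1,2,4,5],
    [0,3,1,2,5,4]] (Orb [[0,2,1,3,4,5]] Auto (Orb [] Auto (Orb [[0,2,1,3,4,5]] Auto Auto))) (Orb
    [] Auto Auto)))) (Orb [[0,1,2,3,5,4]] (Orb [[0,1,3,2,4,5], [1,0,2,3,4,5], [1,0,3,2,4,5]] (Orb
    [] Auto (Orb [] Auto (Orb [] Auto (Orb [] Auto (Orb [] Auto (Orb [[0,1,4,3,2,5]] Auto (Orb
    [[0,1,4,3,2,5]] Auto (Orb [] Auto (Orb [] Auto Auto))))))))) (Orb [] (Orb [] Auto (Orb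
    [[0,1,3,2,4,5], [0,1,3,4,2,5], [1,0,2,3,4,5], [1,0,3,2,4,5], [1,0,3,4,2,5]] Auto Auto)) (Orb
    [] (Orb [[0,1,3,2,4,5], [0,1,3,4,2,5], [1,0,2,3,4,5], [1,0,3,2,4,5], [1,0,3,4,2,5]] Auto (Orb
    [[0,1,2,4,3,5], [0,1,4,2,3,5]] Auto Auto)) (Orb [[0,1,3,2,4,5], [0,1,3,4,2,5], [1,0,2,3,4,5],
    [1,0,3,2,4,5], [1,0,3,4,2,5]] (Orb [] Auto (Orb [[0,1,2,4,3,5]] Auto (Orb [[0,1,2,4,3,5]] Auto
    (Orb [[0,1,2,4,3,5]] Auto Auto)))) (Orb [[0,1,2,4,3,5], [0,1,4,2,3,5]] Auto (Orb
    [[1,0,2,3,4,5]] Auto Auto)))))) (Orb [[0,1,2,3,5,4], [0,1,3,2,4,5], [0,1,3,2,5,4],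
    [1,0,2,3,4,5], [1,0,2,3,5,4], [1,0,3,2,4,5], [1,0,3,2,5,4]] (Orb [] (Orb [[1,0,2,3,4,5]] Auto
    (Orb [] Auto (Orb [[1,0,2,3,4,5]] Auto (Orb [[1,0,2,3,4,5]] Auto (Orb [] Auto Auto))))) (Orb
    [] (Orb [] Auto (Orb [] Auto (Orb [[0,1,3,2,4,5]] Auto (Orb [[0,1,3,2,4,5]] Auto (Orb [] Auto
    Auto))))) (Orb [] (Orb [] Auto (Orb [[1,0,3,2,4,5]] Auto (Orb [[1,0,3,2,4,5]] Auto (Orb []
    Auto (Orb [[1,0,3,2,4,5]] Auto Auto))))) (Orb [] (Orb [] Auto (Orb [] Auto (Orb [] Auto (Orb
    [] Auto (Orb [] Auto (Orb [] Auto Auto)))))) (Orb [] (Orb [] Auto (Orb [] Auto (Orb [] Auto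
    (Orb [] Auto (Orb [] Auto (Orb [] Auto (Orb [] Auto Auto))))))) (Orb [] (Orb [[0,2,1,4,3,5]]
    Auto (Orb [[0,2,1,4,3,5]] Auto (Orb [[0,2,1,4,3,5]] Auto Auto))) (Orb [[0,2,1,4,3,5]] (Orb []
    Auto (Orb [] Auto (Orb [] Auto (Orb [] Auto Auto)))) (Orb [[0,2,1,4,3,5]] (Orb [] Auto (Orb []
    Auto Auto)) (Orb [[0,2,1,4,3,5]] Auto (Orb [] Auto (Orb [] Auto Auto))))))))))) (Orb
    [[0,1,2,3,5,4]] (Orb [] (Orb [[1,0,2,3,4,5]] Auto Auto) (Orb [[1,0,2,3,4,5]] Auto (Orb
    [[0,1,3,2,4,5]] Auto (Orb [[1,0,2,3,4,5]] Auto Auto)))) (Orb [[1,0,2,3,4,5]] (Orb [] Auto (Orb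
    [[0,1,3,2,4,5]] Auto Auto)) (Orb [[0,1,3,2,4,5]] (Orb [] Auto Auto) (Orb [[0,1,2,3,5,4],
    [1,0,2,3,4,5], [1,0,2,3,5,4]] (Orb [] Auto Auto) Auto))))))) (Orb [[0,1,2,3,5,4],
    [0,1,2,5,3,4], [1,0,2,3,4,5], [1,0,2,3,5,4], [1,0,2,5,3,4], [1,2,0,3,4,5], [1,2,0,3,5,4],
    [1,2,0,5,3,4]] (Orb [[0,2,1,3,4,5]] (Orb [] (Orb [[0,1,2,4,3,5], [1,0,2,3,4,5], [1,0,2,4,3,5],
    [1,2,0,3,4,5], [1,2,0,4,3,5]] Auto Auto) (Orb [[0,1,2,4,3,5], [1,0,2,3,4,5], [1,0,2,4,3,5]]
    (Orb [] Auto (Orb [] Auto (Orb [] Auto (Orb [] Auto Auto)))) (Orb [[0,1,2,4,3,5]] Auto (Orb []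
    Auto (Orb [[0,1,2,4,3,5]] Auto Auto))))) (Orb [[0,1,2,4,3,5]] (Orb [[0,2,1,3,4,5]] (Orb []
    Auto (Orb [] Auto (Orb [] Auto Auto))) (Orb [] Auto (Orb [[0,2,1,3,4,5]] Auto (Orb [] Auto
    (Orb [[0,1,2,3,5,4]] Auto Auto))))) (Orb [[0,1,2,4,3,5], [0,2,1,3,4,5], [0,2,1,4,3,5]] (Orb []
    Auto (Orb [] Auto (Orb [] Auto (Orb [] Auto (Orb [[1,0,2,3,5,4], [1,3,5,0,2,4]] Auto Auto)))))
    (Orb [] (Orb [] Auto Auto) (Orb [] (Orb [[0,1,2,4,3,5], [0,2,1,3,4,5], [0,2,1,4,3,5]] Auto
    Auto) (Orb [[0,1,2,4,3,5], [0,2,1,3,4,5], [0,2,1,4,3,5]] (Orb [[0,3,4,1,2,5]] Auto Auto)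
    Auto)))))) (Orb [] (Orb [[0,1,2,3,5,4], [0,1,2,5,3,4], [0,2,1,3,4,5], [0,2,1,3,5,4],
    [0,2,1,5,3,4], [2,0,1,3,4,5], [2,0,1,3,5,4], [2,0,1,5,3,4]] (Orb [[1,0,2,3,4,5],
    [3,4,5,0,1,2], [3,4,5,1,0,2]] Auto Auto) Auto) (Orb [[0,1,2,3,5,4], [0,1,2,5,3,4],
    [0,2,1,3,4,5], [0,2,1,3,5,4], [0,2,1,5,3,4], [2,0,1,3,4,5], [2,0,1,3,5,4], [2,0,1,5,3,4]] (Orb
    [[1,0,2,3,4,5]] (Orb [] Auto (Orb [[0,1,2,4,3,5], [0,2,1,3,4,5], [0,2,1,4,3,5]] Auto Auto))
    (Orb [[0,1,2,4,3,5]] (Orb [[1,0,2,3,4,5]] Auto Auto) (Orb [[0,1,2,4,3,5], [1,0,2,3,4,5],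
    [1,0,2,4,3,5]] Auto Auto))) Auto)))) (Orb [[0,1,2,4,3,5], [0,1,2,4,5,3], [0,1,4,2,3,5],
    [0,1,4,2,5,3], [0,1,4,5,2,3], [0,4,1,2,3,5], [0,4,1,2,5,3], [0,4,1,5,2,3], [0,4,5,1,2,3],
    [4,0,1,2,3,5], [4,0,1,2,5,3], [4,0,1,5,2,3], [4,0,5,1,2,3], [4,5,0,1,2,3]] (Orb
    [[0,1,2,3,5,4], [0,1,3,2,4,5], [0,1,3,2,5,4], [0,3,1,2,4,5], [0,3,1,2,5,4], [3,0,1,2,4,5],
    [3,0,1,2,5,4]] (Orb [[0,2,1,3,4,5], [2,0,1,3,4,5]] (Orb [[1,0,2,3,4,5]] Auto (Orb
    [[0,1,3,2,4,5], [0,1,3,4,2,5]] Auto Auto)) (Orb [] (Orb [[0,1,2,4,3,5], [0,2,1,3,4,5],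
    [0,2,1,4,3,5], [2,0,1,3,4,5], [2,0,1,4,3,5]] Auto Auto) (Orb [[0,1,2,4,3,5], [0,2,1,3,4,5],
    [0,2,1,4,3,5], [2,0,1,3,4,5], [2,0,1,4,3,5]] (Orb [[1,0,2,3,4,5]] Auto Auto) Auto))) Auto)
    Auto))"

lemma symmetries: "list_all (is_symmetry 4) symmetries4" "list_all (is_symmetry 5) symmetries5"
  "list_all (is_symmetry 6) symmetries6"
  by code_simp+

text \<open>The upper bounds 6 here and 20 for five rows are the numbers of candidate columns, so
  column sets of every size are covered.\<close>

lemma check4: "check 4 0 6 symmetries4 [] (candidates 4) certificate4"
  by code_simp

lemma check5: "check 5 0 20 symmetries5 [] (candidates 5) certificate5"
  by code_simp

text \<open>With six rows the search covers only sets of exactly six columns; this is the source of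
  the special case \<open>m = n = 6\<close>.\<close>

lemma check6: "check 6 6 6 symmetries6 [] (candidates 6) certificate6"
  by code_simp

subsection \<open>Relations whose rows and columns are antichains\<close>

lemma length_candidates: "length (candidates 4) = 6" "length (candidates 5) = 20"
  by code_simp+

text \<open>Empty rows are left out, and the conclusion \<open>p = p'\<close> also excludes equal
  rows. The condition on columns is expressed as \<open>row_antichain (T\<inverse>)\<close>.\<close>

definition row_antichain :: "('a \<times> 'b) set \<Rightarrow> bool" where
  "row_antichain T \<longleftrightarrow> (\<forall>p\<in>Domain T. \<forall>p'\<in>Domain T. T `` {p} \<subseteq> T `` {p'} \<longrightarrow> p = p')"

lemma row_antichainD:
  "row_antichain T \<Longrightarrow> p \<in> Domain T \<Longrightarrow> p' \<in> Domain T \<Longrightarrow> T `` {p} \<subseteq> T `` {p'} \<Longrightarrow> p = p'"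
  by (simp add: row_antichain_def)

lemma set_candidates:
  "set (candidates d) = {c. length c = d \<and> 2 \<le> weight c \<and> weight c < d - 1}"
  by (auto simp: candidates_def set_n_lists)

lemma weight_map: "weight (map f [0..<d]) = card {i. i < d \<and> f i}"
proof -
  have "weight (map f [0..<d]) = length (filter f [0..<d])"
    by (simp add: filter_map comp_def)
  also have "\<dots> = card (set (filter f [0..<d]))"
    by (rule distinct_card[symmetric]) simp
  also have "set (filter f [0..<d]) = {i. i < d \<and> f i}"
    by auto
  finally show ?thesis .
qed

text \<open>The rows are numbered by \<open>h\<close>, and each column becomes the characteristic
  vector \<open>v q\<close>. The antichain condition on columns makes \<open>v\<close> injective, so
  \<open>T\<close> is isomorphic to the incidence relation of an admissible set of candidates, to
  which the checked certificates apply.\<close>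

lemma core_shrinkable:
  fixes T :: "('a \<times> 'b) set"
  assumes fin: "finite T" and ne: "T \<noteq> {}"
    and ra: "row_antichain T" and ca: "row_antichain (T\<inverse>)"
    and rows: "\<And>p. p \<in> Domain T \<Longrightarrow> 2 \<le> card (Range T - T `` {p})"
    and cols: "\<And>q. q \<in> Range T \<Longrightarrow> 2 \<le> card (T\<inverse> `` {q}) \<and> 2 \<le> card (Domain T - T\<inverse> `` {q})"
    and size: "card (Domain T) \<le> 5 \<or> card (Domain T) = 6 \<and> card (Range T) = 6"
  shows "shrinkable T"
proof -
  have finD: "finite (Domain T)" and finR: "finite (Range T)"
    using fin by (simp_all add: finite_Domain finite_Range)
  define d where "d = card (Domain T)"
  obtain h where h: "bij_betw h {..<d} (Domain T)"
    using ex_bij_betw_nat_finite[OF finD] by (auto simp: d_def atLeast0LessThan)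
  define v where "v q = map (\<lambda>i. (h i, q) \<in> T) [0..<d]" for q
  define C where "C = v ` Range T"
  have v_nth: "v q ! i \<longleftrightarrow> (h i, q) \<in> T" if "i < d" for q i
    using that by (simp add: v_def)
  have hD: "h i \<in> Domain T" if "i < d" for i
    using h that by (auto simp: bij_betw_def)
  have hex: "\<exists>i<d. h i = p" if "p \<in> Domain T" for p
  proof -
    have "p \<in> h ` {..<d}"
      using h that by (simp add: bij_betw_def)
    then show ?thesis
      by auto
  qed
  have below_v: "q = q'" if q: "q \<in> Range T" "q' \<in> Range T" and le: "below (v q) (v q')" for q q'
  proof (rule row_antichainD[OF ca])
    show "T\<inverse> `` {q} \<subseteq> T\<inverse> `` {q'}"
    proof
      fix p assume p: "p \<in> T\<inverse> `` {q}"
      then obtain i where i: "i < d" "h i = p"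
        using hex by blast
      have "v q' ! i"
        using le i p by (auto simp: below_iff v_def)
      then show "p \<in> T\<inverse> `` {q'}"
        using i v_nth by auto
    qed
  qed (use q in auto)
  have inj: "inj_on v (Range T)"
    by (rule inj_onI) (metis below_v below_refl)
  have card_sub: "card {c \<in> C. P c} = card {q \<in> Range T. P (v q)}" for P
  proof -
    have "{c \<in> C. P c} = v ` {q \<in> Range T. P (v q)}"
      by (auto simp: C_def)
    then show ?thesis
      using inj by (auto intro: card_image inj_on_subset)
  qed
  have cardC: "card C = card (Range T)"
    unfolding C_def using inj by (rule card_image)
  have adm: "admissible d M N C" if "M \<le> card C" "card C \<le> N" for M N
    unfolding admissible_def
  proof (intro conjI)
    show "finite C" "\<forall>c\<in>C. length c = d"
      using finR by (auto simp: C_def v_def)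
    show "M \<le> card C" "card C \<le> N"
      by fact+
    show "\<forall>c\<in>C. \<forall>c'\<in>C. below c c' \<longrightarrow> c = c'"
      using below_v by (auto simp: C_def)
    show "\<forall>p<d. \<forall>q<d. p \<noteq> q \<longrightarrow> (\<exists>c\<in>C. c ! p \<and> \<not> c ! q)"
    proof (intro allI impI)
      fix p q assume pq: "p < d" "q < d" "p \<noteq> q"
      then have "h p \<noteq> h q"
        using h by (auto simp: bij_betw_def inj_on_def)
      then obtain y where "(h p, y) \<in> T" "(h q, y) \<notin> T"
        using row_antichainD[OF ra hD hD] pq by blast
      then show "\<exists>c\<in>C. c ! p \<and> \<not> c ! q"
        using pq by (auto simp: C_def v_nth)
    qed
    show "\<forall>p<d. 2 \<le> card {c \<in> C. \<not> c ! p}"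
    proof (intro allI impI)
      fix p assume p: "p < d"
      have "{q \<in> Range T. \<not> v q ! p} = Range T - T `` {h p}"
        using p by (auto simp: v_nth)
      then show "2 \<le> card {c \<in> C. \<not> c ! p}"
        using rows[OF hD[OF p]] by (simp add: card_sub)
    qed
  qed
  have weight_v: "weight (v q) = card (T\<inverse> `` {q})" for q
  proof -
    have "T\<inverse> `` {q} = h ` {i. i < d \<and> (h i, q) \<in> T}"
      using hex by blast
    moreover have "inj_on h {i. i < d \<and> (h i, q) \<in> T}"
      using h by (auto simp: bij_betw_def intro: inj_on_subset)
    moreover have "weight (v q) = card {i. i < d \<and> (h i, q) \<in> T}"
      unfolding v_def by (rule weight_map)
    ultimately show ?thesis
      by (simp add: card_image)
  qed
  have col_sum: "card (T\<inverse> `` {q}) + card (Domain T - T\<inverse> `` {q}) = d" for q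
  proof -
    have "card (T\<inverse> `` {q} \<union> (Domain T - T\<inverse> `` {q})) = card (T\<inverse> `` {q}) + card (Domain T - T\<inverse> `` {q})"
      using finD by (intro card_Un_disjoint) (auto intro: finite_subset[OF _ finD])
    moreover have "T\<inverse> `` {q} \<union> (Domain T - T\<inverse> `` {q}) = Domain T"
      by auto
    ultimately show ?thesis
      by (simp add: d_def)
  qed
  have cand: "C \<subseteq> set (candidates d)"
  proof
    fix c assume "c \<in> C"
    then obtain q where q: "q \<in> Range T" "c = v q"
      by (auto simp: C_def)
    then show "c \<in> set (candidates d)"
      using cols[OF q(1)] col_sum[of q] by (auto simp: set_candidates weight_v) (simp add: v_def)
  qed
  have le_cand: "card C \<le> length (candidates d)"
    using card_mono[OF _ cand] card_length[of "candidates d"] by simp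
  have main: "shrinkable (incidence d C)"
    if "check d M N \<phi>s [] (candidates d) \<xi>" "list_all (is_symmetry d) \<phi>s" "M \<le> card C" "card C \<le> N" for M N \<phi>s \<xi>
    by (rule check_sound[OF that(1,2) adm[OF that(3,4)]]) (use cand in \<open>simp_all add: set_candidates\<close>)
  obtain q where "q \<in> Range T"
    using ne by auto
  \<comment> \<open>A column contains at least two rows and misses at least two.\<close>
  then have "4 \<le> d"
    using cols[of q] col_sum[of q] by linarith
  then consider "d = 4" | "d = 5" | "d = 6" "card C = 6"
    using size by (fastforce simp: cardC d_def)
  then have "shrinkable (incidence d C)"
  proof cases
    case 1
    show ?thesis
    proof (rule main)
      show "check d 0 6 symmetries4 [] (candidates d) certificate4" "list_all (is_symmetry d) symmetries4"
        using check4 symmetries by (simp_all only: 1)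
      show "card C \<le> 6"
        using le_cand length_candidates by (simp only: 1)
    qed simp
  next
    case 2
    show ?thesis
    proof (rule main)
      show "check d 0 20 symmetries5 [] (candidates d) certificate5" "list_all (is_symmetry d) symmetries5"
        using check5 symmetries by (simp_all only: 2)
      show "card C \<le> 20"
        using le_cand length_candidates by (simp only: 2)
    qed simp
  next
    case 3
    show ?thesis
    proof (rule main)
      show "check d 6 6 symmetries6 [] (candidates d) certificate6" "list_all (is_symmetry d) symmetries6"
        using check6 symmetries by (simp_all only: 3(1))
    qed (use 3 in simp_all)
  qed
  moreover have "incidence d C = map_prod (inv_into {..<d} h) v ` T"
  proof (intro subset_antisym subsetI)
    fix x assume "x \<in> incidence d C"
    then obtain i q where x: "x = (i, v q)" "i < d" "(h i, q) \<in> T"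
      by (auto simp: incidence_def C_def v_nth)
    then have "x = map_prod (inv_into {..<d} h) v (h i, q)"
      using h by (simp add: bij_betw_def)
    then show "x \<in> map_prod (inv_into {..<d} h) v ` T"
      using x by blast
  next
    fix x assume "x \<in> map_prod (inv_into {..<d} h) v ` T"
    then obtain p q where pq: "(p, q) \<in> T" "x = (inv_into {..<d} h p, v q)"
      by auto
    then obtain i where "i < d" "h i = p"
      using hex by blast
    then show "x \<in> incidence d C"
      using pq h by (auto simp: incidence_def C_def v_nth bij_betw_def)
  qed
  moreover have "inj_on (inv_into {..<d} h) (Domain T)"
    using h by (intro inj_on_inv_into) (simp add: bij_betw_def)
  ultimately show ?thesis
    using inj by (intro shrinkable_isomorphic[of "inv_into {..<d} h" T v]) simp_all
qed

section \<open>Splitting off a row together with a column\<close>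

lemma shrinkable_insert_isolated:
  assumes fin: "finite T" and p: "p \<notin> Domain T" and q: "q \<notin> Range T" and shr: "shrinkable T"
  shows "shrinkable (insert (p, q) T)"
proof -
  obtain s t S where S: "card S < card T" "Domain S = Domain T" "Range S = Range T"
    and st: "step s t S = T"
    using shr unfolding shrinkable_def by (elim exE conjE) (rule that)
  have "S \<subseteq> Domain T \<times> Range T"
    by (auto simp flip: S(2,3))
  then have finS: "finite S"
    by (rule finite_subset) (simp add: finite_Domain finite_Range fin)
  have "card (insert (p, q) S) < card (insert (p, q) T)"
    using S(1) p q fin finS by (auto simp: card_insert_if)
  moreover have "step (s(p := p)) (t(q := q)) (insert (p, q) S) = insert (p, q) (step s t S)"
  proof -
    have "map_prod (s(p := p)) id ` S = map_prod s id ` S" "map_prod id (t(q := q)) ` S = map_prod id t ` S"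
      using p q unfolding S(2,3)[symmetric] by (auto intro!: image_cong)
    then show ?thesis
      by (auto simp: step_def)
  qed
  moreover have "Domain (insert (p, q) S) = Domain (insert (p, q) T)" "Range (insert (p, q) S) = Range (insert (p, q) T)"
    using S(2,3) by auto
  ultimately show ?thesis
    unfolding shrinkable_def using st by blast
qed

text \<open>The cross regenerates itself: the row map fixes \<open>p\<close> and the column map
  fixes \<open>q\<close>, so its points \<open>(p, y)\<close> and \<open>(x, q)\<close> survive. It
  also supplies all rows and columns, so \<open>S\<close> may have lost some of those of
  \<open>T\<close>.\<close>

lemma shrinkable_add_cross:
  assumes fin: "finite T" and ne: "T \<noteq> {}" and p: "p \<notin> Domain T" and q: "q \<notin> Range T"
    and S: "S \<subseteq> Domain T \<times> Range T" "card S < card T" and st: "step s t S = T"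
  shows "shrinkable (T \<union> {p} \<times> Range T \<union> Domain T \<times> {q})"
proof -
  define X where "X = {p} \<times> Range T \<union> Domain T \<times> {q}"
  \<comment> \<open>Outside \<open>S\<close> the maps are reset to the identity. Otherwise
    \<open>s\<close> could move \<open>p\<close>, or send a row of \<open>T\<close> that is empty in
    \<open>S\<close> outside \<open>Domain T\<close>; likewise for \<open>t\<close>.\<close>
  define s' where "s' i = (if i \<in> Domain S then s i else i)" for i
  define t' where "t' j = (if j \<in> Range S then t j else j)" for j
  have finX: "finite X" and finS: "finite S"
    using fin S(1) by (auto simp: X_def finite_Domain finite_Range intro: finite_subset)
  have disj: "T \<inter> X = {}" "S \<inter> X = {}"
    using p q S(1) by (auto simp: X_def)
  have s'D: "s' i \<in> Domain T" if "i \<in> Domain T" for i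
  proof (cases "i \<in> Domain S")
    case True
    then obtain j where "(i, j) \<in> S"
      by auto
    then have "(s i, j) \<in> T"
      using st by (auto simp: step_iff)
    then show ?thesis
      using True by (auto simp: s'_def)
  qed (simp add: s'_def that)
  have t'R: "t' j \<in> Range T" if "j \<in> Range T" for j
  proof (cases "j \<in> Range S")
    case True
    then obtain i where "(i, j) \<in> S"
      by auto
    then have "(i, t j) \<in> T"
      using st by (auto simp: step_iff)
    then show ?thesis
      using True by (auto simp: t'_def)
  qed (simp add: t'_def that)
  have pS: "s' p = p" "t' q = q"
    using p q S(1) by (auto simp: s'_def t'_def)
  have "step s' t' S = T"
  proof -
    have "map_prod s' id ` S = map_prod s id ` S" "map_prod id t' ` S = map_prod id t ` S"
      by (auto simp: s'_def t'_def intro!: image_cong)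
    then show ?thesis
      using st by (simp add: step_def)
  qed
  moreover have "step s' t' X = X"
  proof (intro subset_antisym subsetI)
    fix z assume "z \<in> step s' t' X"
    then consider x y where "(x, y) \<in> X" "z = (s' x, y)" | x y where "(x, y) \<in> X" "z = (x, t' y)"
      by (auto simp: step_def)
    then show "z \<in> X"
      using pS s'D t'R unfolding X_def by cases blast+
  next
    fix z assume z: "z \<in> X"
    then consider y where "z = (p, y)" | x where "z = (x, q)"
      by (auto simp: X_def)
    then show "z \<in> step s' t' X"
      using z pS by cases (auto simp: step_iff)
  qed
  moreover have "step s' t' (S \<union> X) = step s' t' S \<union> step s' t' X"
    by (auto simp: step_def)
  ultimately have "step s' t' (S \<union> X) = T \<union> X"
    by simp
  moreover have "card (S \<union> X) < card (T \<union> X)"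
    using S(2) disj finX finS fin by (simp add: card_Un_disjoint)
  moreover have "Domain (S \<union> X) = Domain (T \<union> X)" "Range (S \<union> X) = Range (T \<union> X)"
    using S(1) ne by (auto simp: X_def)
  ultimately have "shrinkable (T \<union> X)"
    unfolding shrinkable_def by blast
  then show ?thesis
    by (simp add: X_def Un_assoc)
qed

text \<open>The single point \<open>(p', q)\<close> replaces two points: moving row
  \<open>p'\<close> to \<open>p\<close> produces \<open>(p, q)\<close>, and moving column
  \<open>q\<close> to \<open>q'\<close> produces \<open>(p', q')\<close>. The other points stay
  fixed, since in a matching none of them lies in row \<open>p'\<close> or column
  \<open>q\<close>.\<close>

lemma isolated_pair_step:
  assumes sv: "single_valued T" "single_valued (T\<inverse>)"
    and T: "(p, q) \<in> T" "(p', q') \<in> T" "p \<noteq> p'"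
  shows "step (id(p' := p)) (id(q := q')) (insert (p', q) (T - {(p, q), (p', q')})) = T"
proof -
  have "q \<noteq> q'"
    using sv(2) T by (auto simp: single_valued_def)
  have iso: "x = p \<longleftrightarrow> y = q" "x = p' \<longleftrightarrow> y = q'" if "(x, y) \<in> T" for x y
    using sv T that by (auto simp: single_valued_def)
  show ?thesis
  proof (intro set_eqI)
    fix z :: "'a \<times> 'b"
    obtain x y where z: "z = (x, y)"
      by (cases z)
    show "z \<in> step (id(p' := p)) (id(q := q')) (insert (p', q) (T - {(p, q), (p', q')})) \<longleftrightarrow> z \<in> T"
      unfolding z step_iff using T iso \<open>q \<noteq> q'\<close> by (auto split: if_splits) metis+
  qed
qed

lemma core_row_sizes:
  assumes fin: "finite T" and ra: "row_antichain T"
    and rows: "\<And>p q. T `` {p} \<noteq> {q}" and cols: "\<And>p q. T\<inverse> `` {q} \<noteq> {p}"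
    and cosingle: "\<And>p q. p \<in> Domain T \<Longrightarrow> q \<in> Range T \<Longrightarrow> T `` {p} \<noteq> Range T - {q}"
    and p: "p \<in> Domain T"
  shows "2 \<le> card (T `` {p}) \<and> 2 \<le> card (Range T - T `` {p})"
proof
  have finR: "finite (Range T)"
    using fin by (rule finite_Range)
  have sub: "T `` {x} \<subseteq> Range T" for x
    by auto
  have "card (T `` {p}) \<noteq> 0"
    using p finite_subset[OF sub finR] by auto
  moreover have "card (T `` {p}) \<noteq> 1"
    using rows by (metis card_1_singletonE)
  ultimately show "2 \<le> card (T `` {p})"
    by linarith
  \<comment> \<open>A full row contains every other row, so in an antichain it is the only one; its
    columns are then singletons, against \<open>cols\<close>.\<close>
  have "card (Range T - T `` {p}) \<noteq> 0"
  proof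
    assume "card (Range T - T `` {p}) = 0"
    then have "T `` {x} \<subseteq> T `` {p}" for x
      using finR sub[of x] by auto
    then have "x = p" if "x \<in> Domain T" for x
      using row_antichainD[OF ra that p] by blast
    moreover obtain q where "(p, q) \<in> T"
      using p by auto
    ultimately have "T\<inverse> `` {q} = {p}"
      by auto
    with cols show False
      by blast
  qed
  moreover have "card (Range T - T `` {p}) \<noteq> 1"
  proof
    assume "card (Range T - T `` {p}) = 1"
    then obtain q where "Range T - T `` {p} = {q}"
      by (rule card_1_singletonE)
    then have "q \<in> Range T" "T `` {p} = Range T - {q}"
      using sub[of p] by blast+
    with cosingle[OF p] show False
      by blast
  qed
  ultimately show "2 \<le> card (Range T - T `` {p})"
    by linarith
qed

text \<open>Symmetric in rows and columns, so that \<open>T\<inverse>\<close> may be used when only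
  the number of columns is small, and inherited when a row and a column are removed: six rows become
  five.\<close>

definition within_bounds :: "('a \<times> 'b) set \<Rightarrow> bool" where
  "within_bounds T \<longleftrightarrow> card (Domain T) \<le> 5 \<or> card (Range T) \<le> 5 \<or> card (Domain T) = 6 \<and> card (Range T) = 6"

lemma within_bounds_remove:
  assumes "within_bounds T" "finite T" "p \<in> Domain T"
    and "Domain T' = Domain T - {p}" "Range T' = Range T - {q}"
  shows "within_bounds T'"
  using assms card_Diff_singleton[of p "Domain T"] card_Diff1_le[of "Range T" q]
  by (auto simp: within_bounds_def)

text \<open>The smaller predecessor loses row \<open>p\<close> and column \<open>q'\<close>. It is
  used where an added cross restores them or where both differ from 0.\<close>

lemma isolated_pair:
  assumes fin: "finite T" and sv: "single_valued T" "single_valued (T\<inverse>)"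
    and T: "(p, q) \<in> T" "(p', q') \<in> T" "p \<noteq> p'"
  defines "S \<equiv> insert (p', q) (T - {(p, q), (p', q')})"
  shows "step (id(p' := p)) (id(q := q')) S = T" and "card S < card T"
    and "Domain S = Domain T - {p}" and "Range S = Range T - {q'}"
proof -
  have "q \<noteq> q'"
    using sv(2) T by (auto simp: single_valued_def)
  have iso: "x = p \<longleftrightarrow> y = q" "x = p' \<longleftrightarrow> y = q'" if "(x, y) \<in> T" for x y
    using sv T that by (auto simp: single_valued_def)
  show "step (id(p' := p)) (id(q := q')) S = T"
    unfolding S_def by (rule isolated_pair_step[OF sv T])
  have "2 \<le> card T"
    using card_mono[OF fin, of "{(p, q), (p', q')}"] T by auto
  moreover have "card (T - {(p, q), (p', q')}) = card T - 2"
    using T fin by (subst card_Diff_subset) auto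
  moreover have "card S \<le> Suc (card (T - {(p, q), (p', q')}))"
    using fin by (simp add: S_def card_insert_if)
  ultimately show "card S < card T"
    by linarith
  show "Domain S = Domain T - {p}"
  proof (intro subset_antisym subsetI)
    fix x assume "x \<in> Domain S"
    then obtain y where "(x, y) = (p', q) \<or> (x, y) \<in> T \<and> (x, y) \<noteq> (p, q)"
      by (auto simp: S_def)
    then show "x \<in> Domain T - {p}"
      using T iso(1)[of x y] by auto
  next
    fix x assume "x \<in> Domain T - {p}"
    then obtain y where "(x, y) \<in> T" "x \<noteq> p"
      by auto
    then show "x \<in> Domain S"
      by (cases "x = p'") (auto simp: S_def)
  qed
  show "Range S = Range T - {q'}"
  proof (intro subset_antisym subsetI)
    fix y assume "y \<in> Range S"
    then obtain x where "(x, y) = (p', q) \<or> (x, y) \<in> T \<and> (x, y) \<noteq> (p', q')"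
      by (auto simp: S_def)
    then show "y \<in> Range T - {q'}"
      using T \<open>q \<noteq> q'\<close> iso(2)[of x y] by auto
  next
    fix y assume "y \<in> Range T - {q'}"
    then obtain x where "(x, y) \<in> T" "y \<noteq> q'"
      by auto
    then show "y \<in> Range S"
      by (cases "y = q") (auto simp: S_def)
  qed
qed

text \<open>A matching has as many points as nonempty rows, so it is never shrinkable and forms the
  exception. The induction on the number of rows removes a singleton row, or a row missing just one
  column, together with that column; otherwise the size conditions of \<open>core_shrinkable\<close>
  hold.\<close>

lemma antichain_dichotomy:
  fixes T :: "('a \<times> 'b) set"
  assumes "finite T" "row_antichain T" "row_antichain (T\<inverse>)" "within_bounds T"
  shows "single_valued T \<and> single_valued (T\<inverse>) \<or> shrinkable T"
  using assms
proof (induction "card (Domain T)" arbitrary: T rule: less_induct)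
  case less
  note fin = less.prems(1) and ra = less.prems(2) and ca = less.prems(3) and bounds = less.prems(4)
  have finD: "finite (Domain T)" and finR: "finite (Range T)"
    using fin by (simp_all add: finite_Domain finite_Range)
  have IH: "single_valued T' \<and> single_valued (T'\<inverse>) \<or> shrinkable T'"
    if "T' \<subseteq> T" "row_antichain T'" "row_antichain (T'\<inverse>)" "p \<in> Domain T"
      "Domain T' = Domain T - {p}" "Range T' = Range T - {q}" for T' p q
  proof (rule less.hyps)
    show "card (Domain T') < card (Domain T)"
      using that finD by (simp only: card_Diff1_less)
    show "finite T'"
      using that(1) fin by (rule finite_subset)
    show "within_bounds T'"
      using bounds fin that(4-6) by (rule within_bounds_remove)
  qed fact+
  show ?case
  proof (cases "\<exists>p q. T `` {p} = {q}")
    case True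
    then obtain p q where row: "T `` {p} = {q}"
      by blast
    then have pq: "(p, q) \<in> T"
      by blast
    \<comment> \<open>A row through \<open>q\<close> contains row \<open>p\<close>, so by the
      antichain property column \<open>q\<close> is \<open>{p}\<close> as well.\<close>
    have col: "x = p" if "(x, q) \<in> T" for x
      using row_antichainD[OF ra DomainI[OF pq] DomainI[OF that]] row that by auto
    define T' where "T' = T - {(p, q)}"
    have T: "T = insert (p, q) T'"
      using pq by (auto simp: T'_def)
    have D: "Domain T' = Domain T - {p}"
      using row by (auto simp: T'_def)
    have R: "Range T' = Range T - {q}"
      using col by (auto simp: T'_def)
    have "row_antichain T'"
      unfolding row_antichain_def
    proof (intro ballI impI)
      fix x y assume xy: "x \<in> Domain T'" "y \<in> Domain T'" "T' `` {x} \<subseteq> T' `` {y}"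
      then have "T `` {x} \<subseteq> T `` {y}"
        unfolding D by (auto simp: T'_def)
      then show "x = y"
        using xy(1,2) unfolding D by (auto intro: row_antichainD[OF ra])
    qed
    moreover have "row_antichain (T'\<inverse>)"
      unfolding row_antichain_def
    proof (intro ballI impI)
      fix x y assume xy: "x \<in> Domain (T'\<inverse>)" "y \<in> Domain (T'\<inverse>)" "T'\<inverse> `` {x} \<subseteq> T'\<inverse> `` {y}"
      then have ne: "x \<noteq> q" "y \<noteq> q"
        using R by auto
      with xy have "T\<inverse> `` {x} \<subseteq> T\<inverse> `` {y}"
        by (auto simp: T'_def)
      then show "x = y"
        using xy(1,2) by (intro row_antichainD[OF ca]) (auto simp: T)
    qed
    ultimately consider "single_valued T'" "single_valued (T'\<inverse>)" | "shrinkable T'"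
      using IH[OF _ _ _ _ D R] pq by (auto simp: T)
    then show ?thesis
    proof cases
      case 1
      have "p \<notin> Domain T'" "q \<notin> Range T'"
        using D R by auto
      then have "single_valued T" "single_valued (T\<inverse>)"
        using 1 by (auto simp: T single_valued_def)
      then show ?thesis
        by blast
    next
      case 2
      have "shrinkable (insert (p, q) T')"
        using fin D R 2 by (intro shrinkable_insert_isolated) (auto simp: T)
      then show ?thesis
        by (simp add: T[symmetric])
    qed
  next
    case False
    then have rows: "T `` {p} \<noteq> {q}" for p q
      by blast
    have cols: "T\<inverse> `` {q} \<noteq> {p}" for p q
    proof
      assume q: "T\<inverse> `` {q} = {p}"
      have "y = q" if "(p, y) \<in> T" for y
        using row_antichainD[OF ca, of q y] q that by auto
      then have "T `` {p} = {q}"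
        using q by blast
      with rows show False
        by blast
    qed
    show ?thesis
    proof (cases "\<exists>p\<in>Domain T. \<exists>q\<in>Range T. T `` {p} = Range T - {q}")
      case True
      then obtain p q where p: "p \<in> Domain T" and q: "q \<in> Range T" and row: "T `` {p} = Range T - {q}"
        by blast
      \<comment> \<open>Another row missing \<open>q\<close> would be contained in row
        \<open>p\<close>, so column \<open>q\<close> contains every row other than
        \<open>p\<close>.\<close>
      have colq: "(x, q) \<in> T" if "x \<in> Domain T" "x \<noteq> p" for x
      proof (rule ccontr)
        assume "(x, q) \<notin> T"
        then have "T `` {x} \<subseteq> T `` {p}"
          unfolding row by auto
        then show False
          using row_antichainD[OF ra that(1) p] that by blast
      qed
      have npq: "(p, q) \<notin> T"
        using row by blast
      have rowp: "(p, y) \<in> T" if "y \<in> Range T" "y \<noteq> q" for y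
        using row that by blast
      define T' where "T' = {(x, y) \<in> T. x \<noteq> p \<and> y \<noteq> q}"
      have sub: "T' \<subseteq> T"
        by (auto simp: T'_def)
      have D: "Domain T' = Domain T - {p}"
      proof (intro subset_antisym subsetI)
        fix x assume x: "x \<in> Domain T - {p}"
        then have "q \<in> T `` {x}"
          using colq by auto
        then obtain y where "y \<noteq> q" "(x, y) \<in> T"
          using rows[of x q] by blast
        then show "x \<in> Domain T'"
          using x by (auto simp: T'_def)
      qed (auto simp: T'_def)
      have R: "Range T' = Range T - {q}"
      proof (intro subset_antisym subsetI)
        fix y assume y: "y \<in> Range T - {q}"
        then have "p \<in> T\<inverse> `` {y}"
          using rowp by auto
        then obtain x where "x \<noteq> p" "(x, y) \<in> T"
          using cols[of y p] by blast
        then show "y \<in> Range T'"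
          using y by (auto simp: T'_def)
      qed (auto simp: T'_def)
      \<comment> \<open>All remaining rows contain \<open>q\<close> and all remaining columns
        contain \<open>p\<close>, so deleting the cross creates no new inclusions.\<close>
      have "row_antichain T'"
        unfolding row_antichain_def
      proof (intro ballI impI)
        fix x y assume xy: "x \<in> Domain T'" "y \<in> Domain T'" "T' `` {x} \<subseteq> T' `` {y}"
        then have "x \<noteq> p" "y \<noteq> p" "x \<in> Domain T" "y \<in> Domain T"
          using D by auto
        moreover from this have "T `` {x} \<subseteq> T `` {y}"
          using xy(3) colq[of y] by (auto simp: T'_def)
        ultimately show "x = y"
          by (intro row_antichainD[OF ra])
      qed
      moreover have "row_antichain (T'\<inverse>)"
        unfolding row_antichain_def
      proof (intro ballI impI)
        fix x y assume xy: "x \<in> Domain (T'\<inverse>)" "y \<in> Domain (T'\<inverse>)" "T'\<inverse> `` {x} \<subseteq> T'\<inverse> `` {y}"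
        then have "x \<noteq> q" "y \<noteq> q" "x \<in> Range T" "y \<in> Range T"
          using R by auto
        moreover from this have "T\<inverse> `` {x} \<subseteq> T\<inverse> `` {y}"
          using xy(3) rowp[of y] by (auto simp: T'_def)
        ultimately show "x = y"
          by (intro row_antichainD[OF ca]) auto
      qed
      ultimately have "single_valued T' \<and> single_valued (T'\<inverse>) \<or> shrinkable T'"
        using IH[OF sub _ _ p D R] by blast
      then have "\<exists>s t S. S \<subseteq> Domain T' \<times> Range T' \<and> card S < card T' \<and> step s t S = T'"
      proof
        assume "shrinkable T'"
        then obtain s t S where S: "card S < card T'" "Domain S = Domain T'" "Range S = Range T'" "step s t S = T'"
          unfolding shrinkable_def by (elim exE conjE) (rule that)
        moreover have "S \<subseteq> Domain T' \<times> Range T'"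
          by (auto simp flip: S(2,3))
        ultimately show ?thesis
          by blast
      next
        assume sv: "single_valued T' \<and> single_valued (T'\<inverse>)"
        \<comment> \<open>A matching is not shrinkable, but row \<open>p\<close> has at least two
          elements, so \<open>T'\<close> has two points that can be merged. The row and column lost
          by this are restored by the cross.\<close>
        obtain b where b: "(p, b) \<in> T"
          using p by auto
        obtain b' where b': "(p, b') \<in> T" "b' \<noteq> b"
          using rows[of p b] b by blast
        have "b \<in> Range T'" "b' \<in> Range T'"
          using b b'(1) npq by (auto simp: R)
        then obtain a a' where a: "(a, b) \<in> T'" "(a', b') \<in> T'"
          by (elim RangeE) (rule that)
        then have "a \<noteq> a'"
          using sv b'(2) by (auto simp: single_valued_def)
        note iso = isolated_pair[OF finite_subset[OF sub fin] sv[THEN conjunct1] sv[THEN conjunct2] a this]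
        show ?thesis
          using iso(1,2) iso(3,4)[THEN equalityD1] by (intro exI conjI) (auto simp: subset_iff)
      qed
      then obtain s t S where S: "S \<subseteq> Domain T' \<times> Range T'" "card S < card T'" "step s t S = T'"
        by blast
      have "shrinkable (T' \<union> {p} \<times> Range T' \<union> Domain T' \<times> {q})"
      proof (rule shrinkable_add_cross[OF _ _ _ _ S])
        show "finite T'"
          using sub fin by (rule finite_subset)
        show "T' \<noteq> {}"
          using S(2) by auto
      qed (simp_all add: D R)
      also have "T' \<union> {p} \<times> Range T' \<union> Domain T' \<times> {q} = T"
        unfolding D R using rowp colq npq by (auto simp: T'_def)
      finally show ?thesis
        by blast
    next
      case False
      have corow: "T `` {p} \<noteq> Range T - {q}" if "p \<in> Domain T" "q \<in> Range T" for p q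
        using False that by blast
      \<comment> \<open>If column \<open>q\<close> misses just row \<open>p\<close>, a further
        column missing \<open>p\<close> would be contained in it; hence row \<open>p\<close> misses
        just \<open>q\<close>.\<close>
      have cocol: "T\<inverse> `` {q} \<noteq> Domain T - {p}" if "q \<in> Range T" "p \<in> Domain T" for p q
      proof
        assume col: "T\<inverse> `` {q} = Domain T - {p}"
        have "(p, y) \<in> T" if y: "y \<in> Range T" "y \<noteq> q" for y
        proof (rule ccontr)
          assume "(p, y) \<notin> T"
          then have "T\<inverse> `` {y} \<subseteq> T\<inverse> `` {q}"
            unfolding col by auto
          then show False
            using row_antichainD[OF ca, of y q] y \<open>q \<in> Range T\<close> by auto
        qed
        then have "T `` {p} = Range T - {q}"
          using col by blast
        with corow that show False
          by blast
      qed
      have row_sizes: "2 \<le> card (T `` {p}) \<and> 2 \<le> card (Range T - T `` {p})" if "p \<in> Domain T" for p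
        using fin ra rows cols corow that by (rule core_row_sizes)
      have col_sizes: "2 \<le> card (T\<inverse> `` {q}) \<and> 2 \<le> card (Domain T - T\<inverse> `` {q})" if "q \<in> Range T" for q
        using core_row_sizes[of "T\<inverse>" q] fin ca rows cols cocol that by simp
      have "shrinkable T" if "T \<noteq> {}"
      proof (cases "card (Domain T) \<le> 5 \<or> card (Domain T) = 6 \<and> card (Range T) = 6")
        case True
        show ?thesis
          using fin that ra ca row_sizes col_sizes True by (intro core_shrinkable) auto
      next
        case False
        then have "card (Domain (T\<inverse>)) \<le> 5"
          using bounds by (auto simp: within_bounds_def)
        then have "shrinkable (T\<inverse>)"
          using fin that ra ca row_sizes col_sizes by (intro core_shrinkable) auto
        then show ?thesis
          by (rule shrinkable_converse)
      qed
      then show ?thesis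
        by (auto simp: single_valued_def)
    qed
  qed
qed

subsection \<open>Reachability\<close>

inductive reachable :: "nat \<Rightarrow> nat \<Rightarrow> (nat \<times> nat) set \<Rightarrow> bool" for m n where
  start: "reachable m n {(0, 0)}"
| step: "reachable m n S \<Longrightarrow> s \<in> {..<m} \<rightarrow> {..<m} \<Longrightarrow> t \<in> {..<n} \<rightarrow> {..<n} \<Longrightarrow> reachable m n (step s t S)"

text \<open>If column \<open>j\<close> is contained in column \<open>k\<close>, the common points
  can be deleted from column \<open>k\<close>, since adding \<open>j\<close> to \<open>k\<close>
  brings them back. A row that loses its point in \<open>k\<close> keeps its point in
  \<open>j\<close>.\<close>

lemma comparable_columns_predecessor:
  assumes fin: "finite T" and comp: "\<not> row_antichain (T\<inverse>)"
    and a: "a \<in> Domain T" and b: "b \<in> Range T"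
  obtains S j k where "S \<subseteq> T" "card S < card T" "a \<in> Domain S" "b \<in> Range S"
    "j \<in> Range T" "k \<in> Range T" "step id (id(j := k)) S = T"
proof -
  \<comment> \<open>If the two columns are equal, column \<open>k\<close> becomes empty; the roles
    of \<open>j\<close> and \<open>k\<close> are then chosen so that \<open>k\<close> is not
    \<open>b\<close>.\<close>
  obtain j k where jk: "j \<in> Range T" "k \<in> Range T" "T\<inverse> `` {j} \<subseteq> T\<inverse> `` {k}" "j \<noteq> k"
    and kb: "k = b \<Longrightarrow> \<not> T\<inverse> `` {k} \<subseteq> T\<inverse> `` {j}"
  proof -
    obtain j k where jk: "j \<in> Range T" "k \<in> Range T" "T\<inverse> `` {j} \<subseteq> T\<inverse> `` {k}" "j \<noteq> k"
      using comp by (auto simp: row_antichain_def)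
    show thesis
    proof (cases "k = b \<and> T\<inverse> `` {k} \<subseteq> T\<inverse> `` {j}")
      case True
      then show thesis
        using jk by (intro that[of k j]) auto
    next
      case False
      then show thesis
        using jk by (intro that[of j k]) auto
    qed
  qed
  have le: "(x, k) \<in> T" if "(x, j) \<in> T" for x
    using jk(3) that by auto
  define S where "S = {(x, y) \<in> T. y = k \<longrightarrow> (x, j) \<notin> T}"
  have S: "S \<subseteq> T"
    by (auto simp: S_def)
  obtain x where "(x, j) \<in> T"
    using jk(1) by auto
  then have "(x, k) \<in> T - S"
    using le by (auto simp: S_def)
  then have "card S < card T"
    using S fin by (intro psubset_card_mono) auto
  moreover have "a \<in> Domain S"
  proof -
    obtain y where y: "(a, y) \<in> T"
      using a by auto
    then have "(a, y) \<in> S \<or> (a, j) \<in> S"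
      using jk(4) by (auto simp: S_def)
    then show ?thesis
      by auto
  qed
  moreover have "b \<in> Range S"
  proof (cases "b = k")
    case True
    then obtain x where "(x, k) \<in> T" "(x, j) \<notin> T"
      using kb by auto
    then show ?thesis
      by (auto simp: S_def True)
  next
    case False
    then show ?thesis
      using b by (auto simp: S_def)
  qed
  moreover have "step id (id(j := k)) S = T"
  proof (intro subset_antisym subsetI)
    fix z assume "z \<in> step id (id(j := k)) S"
    then show "z \<in> T"
      using le by (auto simp: step_def S_def split: if_splits)
  next
    fix z assume z: "z \<in> T"
    obtain x y where xy: "z = (x, y)"
      by (cases z)
    show "z \<in> step id (id(j := k)) S"
    proof (cases "z \<in> S")
      case False
      then have "y = k" "(x, j) \<in> S"
        using z jk(4) by (auto simp: S_def xy)
      then show ?thesis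
        by (auto simp: step_iff xy)
    qed (auto simp: step_iff xy)
  qed
  ultimately show thesis
    using that[OF S] jk(1,2) by blast
qed

text \<open>Comparable rows or columns and shrinkable antichains yield a smaller predecessor at
  once. There remain the matchings, where points are merged as long as this keeps row 0 and column
  0.\<close>

lemma reachable_all:
  assumes mn: "m \<le> 5 \<or> n \<le> 5 \<or> m = 6 \<and> n = 6"
    and "T \<subseteq> {..<m} \<times> {..<n}" "0 \<in> Domain T" "0 \<in> Range T"
  shows "reachable m n T"
  using assms(2-)
proof (induction "card T" arbitrary: T rule: less_induct)
  case less
  note T = less.prems(1) and zero = less.prems(2,3)
  have fin: "finite T"
    using T by (rule finite_subset) simp
  have D: "Domain T \<subseteq> {..<m}" and R: "Range T \<subseteq> {..<n}"
    using T by auto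
  have cD: "card (Domain T) \<le> m" and cR: "card (Range T) \<le> n"
    using card_mono[OF _ D] card_mono[OF _ R] by simp_all
  have pred: "reachable m n T"
    if S: "S \<subseteq> {..<m} \<times> {..<n}" "card S < card T" "0 \<in> Domain S" "0 \<in> Range S"
      and st: "step s t S = T" "s \<in> {..<m} \<rightarrow> {..<m}" "t \<in> {..<n} \<rightarrow> {..<n}" for s t S
    using reachable.step[OF less.hyps[OF S(2,1,3,4)] st(2,3)] st(1) by simp
  show ?case
  proof (cases "row_antichain T \<and> row_antichain (T\<inverse>)")
    case False
    then consider "\<not> row_antichain (T\<inverse>)" | "\<not> row_antichain ((T\<inverse>)\<inverse>)"
      by auto
    then show ?thesis
    proof cases
      case 1
      obtain S j k where S: "S \<subseteq> T" "card S < card T" "0 \<in> Domain S" "0 \<in> Range S"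
        "j \<in> Range T" "k \<in> Range T" "step id (id(j := k)) S = T"
        using comparable_columns_predecessor[OF fin 1 zero] .
      then show ?thesis
        using T R by (intro pred[of S id "id(j := k)"]) auto
    next
      case 2
      obtain S j k where S: "S \<subseteq> T\<inverse>" "card S < card (T\<inverse>)" "0 \<in> Domain S" "0 \<in> Range S"
        "j \<in> Range (T\<inverse>)" "k \<in> Range (T\<inverse>)" and st: "step id (id(j := k)) S = T\<inverse>"
        using comparable_columns_predecessor[of "T\<inverse>" 0 0] fin 2 zero by auto
      have "step (id(j := k)) id (S\<inverse>) = T"
        using st by (metis converse_converse step_converse)
      moreover have "S\<inverse> \<subseteq> T"
        using S(1) by auto
      ultimately show ?thesis
        using T D S by (intro pred[of "S\<inverse>" "id(j := k)" id]) auto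
    qed
  next
    case True
    have "within_bounds T"
      using mn cD cR unfolding within_bounds_def by linarith
    then consider "single_valued T" "single_valued (T\<inverse>)" | "shrinkable T"
      using antichain_dichotomy[OF fin] True by blast
    then show ?thesis
    proof cases
      case 2
      obtain s t S where S: "card S < card T" "Domain S = Domain T" "Range S = Range T" "step s t S = T"
        using 2 unfolding shrinkable_def by (elim exE conjE) (rule that)
      \<comment> \<open>On the rows of \<open>S\<close> the values of \<open>s\<close> are rows of
        \<open>T\<close>; elsewhere the identity is taken, so that \<open>s'\<close> is a
        transformation of \<open>{..<m}\<close>. The same is done for the columns.\<close>
      define s' where "s' i = (if i \<in> Domain S then s i else i)" for i
      define t' where "t' j = (if j \<in> Range S then t j else j)" for j
      have "map_prod s' id ` S = map_prod s id ` S" "map_prod id t' ` S = map_prod id t ` S"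
        by (auto simp: s'_def t'_def intro!: image_cong)
      then have st: "step s' t' S = T"
        using S(4) by (simp add: step_def)
      have "S \<subseteq> Domain T \<times> Range T"
        by (auto simp flip: S(2,3))
      then have "S \<subseteq> {..<m} \<times> {..<n}"
        using D R by blast
      moreover have "s' i < m" if "i < m" for i
      proof (cases "i \<in> Domain S")
        case True
        then obtain j where "(i, j) \<in> S"
          by auto
        then have "(s' i, j) \<in> T"
          using st by (auto simp: step_iff)
        then show ?thesis
          using T by auto
      qed (simp add: s'_def that)
      moreover have "t' j < n" if "j < n" for j
      proof (cases "j \<in> Range S")
        case True
        then obtain i where "(i, j) \<in> S"
          by auto
        then have "(i, t' j) \<in> T"
          using st by (auto simp: step_iff)
        then show ?thesis
          using T by auto
      qed (simp add: t'_def that)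
      ultimately show ?thesis
        using st S(1) zero by (intro pred[of S s' t']) (auto simp: S(2,3))
    next
      case 1
      obtain p\<^sub>0 q\<^sub>0 where p0: "(p\<^sub>0, 0) \<in> T" and q0: "(0, q\<^sub>0) \<in> T"
        using zero by auto
      have mn0: "0 < m" "0 < n"
        using p0 q0 T by auto
      show ?thesis
      proof (cases "\<exists>p q p' q'. (p, q) \<in> T \<and> (p', q') \<in> T \<and> p \<noteq> p' \<and> p \<noteq> 0 \<and> q' \<noteq> 0")
        case True
        \<comment> \<open>Merging the two points empties row \<open>p\<close> and column
          \<open>q'\<close>, which is allowed because neither is 0.\<close>
        then obtain p q p' q' where pq: "(p, q) \<in> T" "(p', q') \<in> T" "p \<noteq> p'" "p \<noteq> 0" "q' \<noteq> 0"
          by blast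
        note iso = isolated_pair[OF fin 1 pq(1-3)]
        show ?thesis
        proof (rule pred[OF _ iso(2) _ _ iso(1)])
          show "insert (p', q) (T - {(p, q), (p', q')}) \<subseteq> {..<m} \<times> {..<n}"
            using T pq by auto
          show "0 \<in> Domain (insert (p', q) (T - {(p, q), (p', q')}))"
            using zero pq by (simp only: iso(3)) simp
          show "0 \<in> Range (insert (p', q) (T - {(p, q), (p', q')}))"
            using zero pq by (simp only: iso(4)) simp
          show "id(p' := p) \<in> {..<m} \<rightarrow> {..<m}" "id(q := q') \<in> {..<n} \<rightarrow> {..<n}"
            using T pq by auto
        qed
      next
        case False
        then have small: "p = 0 \<or> q' = 0 \<or> p = p'" if "(p, q) \<in> T" "(p', q') \<in> T" for p q p' q'
          using that by blast
        show ?thesis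
        proof (cases "Domain T = {0}")
          case True
          then have dom: "a = 0" if "(a, b) \<in> T" for a b
            using that by blast
          then have "(0, 0) \<in> T"
            using p0 by blast
          moreover from this have "b = 0" if "(a, b) \<in> T" for a b
            using 1(1) dom[OF that] that by (auto simp: single_valued_def)
          ultimately have "T = {(0, 0)}"
            using dom by auto
          then show ?thesis
            by (simp add: reachable.start)
        next
          case False
          then obtain p q where pq: "(p, q) \<in> T" "p \<noteq> 0"
            using zero(1) by auto
          have "q\<^sub>0 = 0"
            using small[OF pq(1) q0] pq(2) by auto
          have sv: "b = c" if "(a, b) \<in> T" "(a, c) \<in> T" for a b c
            using 1(1) that by (auto simp: single_valued_def)
          have sv': "a = b" if "(a, c) \<in> T" "(b, c) \<in> T" for a b c
            using 1(2) that by (auto simp: single_valued_def)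
          have "(p', q') = (p, q) \<or> (p', q') = (0, 0)" if "(p', q') \<in> T" for p' q'
          proof (cases "p' = p")
            case True
            then show ?thesis
              using sv[OF pq(1)] that by simp
          next
            case False
            then have "q' = 0"
              using small[OF pq(1) that] pq(2) by auto
            then show ?thesis
              using sv'[OF q0, of p'] that \<open>q\<^sub>0 = 0\<close> by simp
          qed
          then have Teq: "T = {(0, 0), (p, q)}"
            using pq(1) q0 \<open>q\<^sub>0 = 0\<close> by auto
          have "q \<noteq> 0"
            using sv'[OF pq(1), of 0] pq(2) q0 \<open>q\<^sub>0 = 0\<close> by metis
          have lt: "p < m" "q < n"
            using T pq by auto
          \<comment> \<open>The relation \<open>{(0, 0), (p, q)}\<close> is reached from the start
            in two explicit steps: via \<open>{(p, 0), (0, q)}\<close>, to which the transpositions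
            of 0 with \<open>p\<close> and of 0 with \<open>q\<close> are applied.\<close>
          have "reachable m n (step (id(0 := p)) (id(0 := q)) {(0, 0)})"
            using lt by (intro reachable.intros) auto
          also have "step (id(0 := p)) (id(0 := q)) {(0, 0)} = {(p, 0), (0, q)}"
            by (auto simp: step_def)
          finally have "reachable m n (step (id(0 := p, p := 0)) (id(0 := q, q := 0)) {(p, 0), (0, q)})"
            using lt mn0 by (intro reachable.step) auto
          also have "step (id(0 := p, p := 0)) (id(0 := q, q := 0)) {(p, 0), (0, q)} = T"
            using pq(2) \<open>q \<noteq> 0\<close> by (auto simp: step_def Teq)
          finally show ?thesis .
        qed
      qed
    qed
  qed
qed

subsection \<open>The subset automaton of the shuffle\<close>

text \<open>Send each state of \<open>A\<close> to the state of \<open>B\<close> reached by one of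
  its access words. A word separating two states of \<open>A\<close> also separates their images, so
  this is injective.\<close>

lemma state_complexity_minimal:
  fixes A :: "('q, 'a) dfa"
  assumes A: "complete_dfa \<Sigma> A"
    and reach: "\<And>q. q \<in> states A \<Longrightarrow> \<exists>w\<in>lists \<Sigma>. foldl (delta A) (init A) w = q"
    and dist: "\<And>p q. p \<in> states A \<Longrightarrow> q \<in> states A \<Longrightarrow> p \<noteq> q \<Longrightarrow>
      \<exists>w\<in>lists \<Sigma>. (foldl (delta A) p w \<in> final A) \<noteq> (foldl (delta A) q w \<in> final A)"
  shows "state_complexity \<Sigma> (dfa_lang \<Sigma> A) = card (states A)"
  unfolding state_complexity_def
proof (rule Least_equality)
  show "\<exists>B :: (nat, 'a) dfa. complete_dfa \<Sigma> B \<and> dfa_lang \<Sigma> B = dfa_lang \<Sigma> A \<and> card (states B) = card (states A)"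
    using A by (rule dfa_nat_states)
next
  fix k
  assume "\<exists>B :: (nat, 'a) dfa. complete_dfa \<Sigma> B \<and> dfa_lang \<Sigma> B = dfa_lang \<Sigma> A \<and> card (states B) = k"
  then obtain B :: "(nat, 'a) dfa" where B: "complete_dfa \<Sigma> B" "dfa_lang \<Sigma> B = dfa_lang \<Sigma> A" "card (states B) = k"
    by blast
  obtain W where W: "\<And>q. q \<in> states A \<Longrightarrow> W q \<in> lists \<Sigma> \<and> foldl (delta A) (init A) (W q) = q"
    using reach by metis
  define f where "f q = foldl (delta B) (init B) (W q)" for q
  have run: "foldl (delta B) q w \<in> states B" if "w \<in> lists \<Sigma>" "q \<in> states B" for w q
    using that by (induction w arbitrary: q) (use B(1) in \<open>auto simp: complete_dfa_def\<close>)
  have "f q \<in> states B" if "q \<in> states A" for q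
    unfolding f_def using W[OF that] B(1) by (intro run) (auto simp: complete_dfa_def)
  moreover have "inj_on f (states A)"
  proof (rule inj_onI, rule ccontr)
    fix p q assume pq: "p \<in> states A" "q \<in> states A" "f p = f q" "p \<noteq> q"
    then obtain w where w: "w \<in> lists \<Sigma>" "(foldl (delta A) p w \<in> final A) \<noteq> (foldl (delta A) q w \<in> final A)"
      using dist by blast
    have "x \<in> lists \<Sigma> \<Longrightarrow> foldl (delta A) (init A) x \<in> final A \<longleftrightarrow> foldl (delta B) (init B) x \<in> final B" for x
      using B(2) by (auto simp: dfa_lang_def set_eq_iff)
    from this[of "W p @ w"] this[of "W q @ w"] show False
      using W pq w by (auto simp: f_def)
  qed
  ultimately have "card (states A) \<le> card (states B)"
    using B(1) by (intro card_inj_on_le) (auto simp: complete_dfa_def)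
  then show "card (states A) \<le> k"
    by (simp add: B(3))
qed

text \<open>Each letter is read by exactly one of the two components, so the subset automaton
  follows all ways of distributing \<open>w\<close> over a pair \<open>u\<close>, \<open>v\<close>.
  The start set is arbitrary for the sake of the induction.\<close>

lemma foldl_step_iff:
  "(p', q') \<in> foldl (\<lambda>S a. step (\<lambda>p. f p a) (\<lambda>q. g q a) S) S w \<longleftrightarrow>
    (\<exists>u v p q. w \<in> shuffles u v \<and> (p, q) \<in> S \<and> foldl f p u = p' \<and> foldl g q v = q')"
proof (induction w arbitrary: S)
  case Nil
  then show ?case
    by simp
next
  case (Cons a w)
  show ?case
    unfolding foldl.simps Cons.IH
  proof
    assume "\<exists>u v p q. w \<in> shuffles u v \<and> (p, q) \<in> step (\<lambda>p. f p a) (\<lambda>q. g q a) S \<and> foldl f p u = p' \<and> foldl g q v = q'"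
    then obtain u v p q where w: "w \<in> shuffles u v" "(p, q) \<in> step (\<lambda>p. f p a) (\<lambda>q. g q a) S"
      "foldl f p u = p'" "foldl g q v = q'"
      by blast
    then consider r where "(r, q) \<in> S" "f r a = p" | r where "(p, r) \<in> S" "g r a = q"
      by (auto simp: step_iff)
    then show "\<exists>u v p q. a # w \<in> shuffles u v \<and> (p, q) \<in> S \<and> foldl f p u = p' \<and> foldl g q v = q'"
    proof cases
      case (1 r)
      then show ?thesis
        using w by (intro exI[of _ "a # u"] exI[of _ v] exI[of _ r] exI[of _ q])
          (auto intro: Cons_in_shuffles_leftI)
    next
      case (2 r)
      then show ?thesis
        using w by (intro exI[of _ u] exI[of _ "a # v"] exI[of _ p] exI[of _ r])
          (auto intro: Cons_in_shuffles_rightI)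
    qed
  next
    assume "\<exists>u v p q. a # w \<in> shuffles u v \<and> (p, q) \<in> S \<and> foldl f p u = p' \<and> foldl g q v = q'"
    then obtain u v p q where w: "a # w \<in> shuffles u v" "(p, q) \<in> S" "foldl f p u = p'" "foldl g q v = q'"
      by blast
    from w(1) consider u' where "u = a # u'" "w \<in> shuffles u' v" | v' where "v = a # v'" "w \<in> shuffles u v'"
      by (auto simp: Cons_in_shuffles_iff neq_Nil_conv)
    then show "\<exists>u v p q. w \<in> shuffles u v \<and> (p, q) \<in> step (\<lambda>p. f p a) (\<lambda>q. g q a) S \<and> foldl f p u = p' \<and> foldl g q v = q'"
    proof cases
      case 1
      then have "(f p a, q) \<in> step (\<lambda>p. f p a) (\<lambda>q. g q a) S"
        using w by (auto simp: step_iff)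
      then show ?thesis
        using w 1 by auto
    next
      case 2
      then have "(p, g q a) \<in> step (\<lambda>p. f p a) (\<lambda>q. g q a) S"
        using w by (auto simp: step_iff)
      then show ?thesis
        using w 2 by auto
    qed
  qed
qed

section \<open>The states of the subset automaton and their number\<close>

definition valid_states :: "nat \<Rightarrow> nat \<Rightarrow> (nat \<times> nat) set set" where
  "valid_states m n = {S. S \<subseteq> {..<m} \<times> {..<n} \<and> 0 \<in> Domain S \<and> 0 \<in> Range S}"

text \<open>Sets containing \<open>(0, 0)\<close> give the first summand. The others consist of
  nonempty parts of the rest of row 0 and of the rest of column 0, and an arbitrary part of the
  remaining rectangle.\<close>

lemma card_valid_states:
  assumes "0 < m" "0 < n"
  shows "card (valid_states m n) = shuffle_bound m n"
proof -
  define G where "G = {..<m} \<times> {..<n}"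
  define R where "R = {0::nat} \<times> {1..<n}"
  define C where "C = {1..<m} \<times> {0::nat}"
  define X where "X = {1..<m} \<times> {1..<n}"
  have fin: "finite G" "finite R" "finite C" "finite X"
    by (simp_all add: G_def R_def C_def X_def)
  have card: "card G = m * n" "card R = n - 1" "card C = m - 1" "card X = (m - 1) * (n - 1)"
    by (simp_all add: G_def R_def C_def X_def card_cartesian_product)
  have G: "G = insert (0, 0) (R \<union> C \<union> X)"
    using assms by (auto simp: G_def R_def C_def X_def)
  let ?A = "insert (0, 0) ` Pow (G - {(0, 0)})"
  let ?P = "(Pow R - {{}}) \<times> (Pow C - {{}}) \<times> Pow X"
  let ?u = "\<lambda>(r, c, x). r \<union> c \<union> x"
  let ?B = "?u ` ?P"
  have split: "valid_states m n = ?A \<union> ?B"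
  proof (intro subset_antisym subsetI)
    fix S assume S: "S \<in> valid_states m n"
    then have sub: "S \<subseteq> G"
      by (simp add: valid_states_def G_def)
    show "S \<in> ?A \<union> ?B"
    proof (cases "(0, 0) \<in> S")
      case True
      then have "S = insert (0, 0) (S - {(0, 0)})"
        by auto
      moreover have "S - {(0, 0)} \<in> Pow (G - {(0, 0)})"
        using sub by auto
      ultimately show ?thesis
        by blast
    next
      case False
      obtain p q where "(0, q) \<in> S" "(p, 0) \<in> S"
        using S by (auto simp: valid_states_def)
      moreover from this have "q \<noteq> 0" "p \<noteq> 0"
        using False by (metis gr0I)+
      ultimately have "(0, q) \<in> S \<inter> R" "(p, 0) \<in> S \<inter> C"
        using sub by (auto simp: G_def R_def C_def)
      moreover have "S = S \<inter> R \<union> S \<inter> C \<union> S \<inter> X"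
        using sub False unfolding G by blast
      ultimately have "S = ?u (S \<inter> R, S \<inter> C, S \<inter> X)" "(S \<inter> R, S \<inter> C, S \<inter> X) \<in> ?P"
        by auto
      then show ?thesis
        by blast
    qed
  next
    fix S assume "S \<in> ?A \<union> ?B"
    then show "S \<in> valid_states m n"
    proof
      assume "S \<in> ?A"
      then show ?thesis
        using assms by (auto simp: valid_states_def G_def)
    next
      assume "S \<in> ?B"
      then obtain r c x where S: "S = r \<union> c \<union> x" "r \<subseteq> R" "c \<subseteq> C" "x \<subseteq> X" "r \<noteq> {}" "c \<noteq> {}"
        by auto
      then obtain p q where "(0, q) \<in> S" "(p, 0) \<in> S"
        by (fastforce simp: R_def C_def)
      moreover have "S \<subseteq> G"
        using S unfolding G by blast
      ultimately show ?thesis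
        by (auto simp: valid_states_def G_def)
    qed
  qed
  have "inj_on (insert (0, 0)) (Pow (G - {(0, 0)}))"
    by (rule inj_onI) blast
  then have A: "card ?A = 2 ^ (m * n - 1)"
    using assms fin by (simp add: card_image card_Pow card card_Diff_singleton G_def)
  have disj: "R \<inter> C = {}" "R \<inter> X = {}" "C \<inter> X = {}"
    by (auto simp: R_def C_def X_def)
  have "inj_on ?u ?P"
  proof (rule inj_onI)
    fix y z assume yz: "y \<in> ?P" "z \<in> ?P" "?u y = ?u z"
    have proj: "(r \<union> c \<union> x) \<inter> R = r" "(r \<union> c \<union> x) \<inter> C = c" "(r \<union> c \<union> x) \<inter> X = x"
      if "r \<subseteq> R" "c \<subseteq> C" "x \<subseteq> X" for r c x
      using that disj by blast+
    obtain r c x where y: "y = (r, c, x)"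
      by (cases y)
    obtain r' c' x' where z: "z = (r', c', x')"
      by (cases z)
    have sub: "r \<subseteq> R" "c \<subseteq> C" "x \<subseteq> X" "r' \<subseteq> R" "c' \<subseteq> C" "x' \<subseteq> X"
      using yz(1,2) by (auto simp: y z)
    have "r \<union> c \<union> x = r' \<union> c' \<union> x'"
      using yz(3) by (simp add: y z)
    then have "r = r'" "c = c'" "x = x'"
      using proj[OF sub(1-3)] proj[OF sub(4-6)] by simp_all
    then show "y = z"
      by (simp add: y z)
  qed
  then have "card ?B = card ?P"
    by (rule card_image)
  also have "\<dots> = 2 ^ ((m - 1) * (n - 1)) * (2 ^ (m - 1) - 1) * (2 ^ (n - 1) - 1)"
    using fin by (simp add: card_cartesian_product card_Pow card card_Diff_singleton)
  finally have B: "card ?B = 2 ^ ((m - 1) * (n - 1)) * (2 ^ (m - 1) - 1) * (2 ^ (n - 1) - 1)" .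
  have notB: "(0, 0) \<notin> S" if "S \<in> ?B" for S
    using that by (auto simp: R_def C_def X_def)
  have "?A \<inter> ?B = {}"
  proof (rule equals0I)
    fix S assume S: "S \<in> ?A \<inter> ?B"
    then have "(0, 0) \<in> S"
      using IntD1[OF S] by (elim imageE) simp
    then show False
      using notB[OF IntD2[OF S]] by simp
  qed
  then have "card (valid_states m n) = card ?A + card ?B"
    unfolding split using fin by (intro card_Un_disjoint) auto
  then show ?thesis
    by (simp only: A B shuffle_bound_def)
qed

text \<open>A point in row 0 stays there when only its column moves, and dually; hence every
  reachable set meets row 0 and column 0.\<close>

lemma step_valid_states:
  assumes "S \<in> valid_states m n" "s \<in> {..<m} \<rightarrow> {..<m}" "t \<in> {..<n} \<rightarrow> {..<n}"
  shows "step s t S \<in> valid_states m n"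
proof -
  obtain p q where "(0, q) \<in> S" "(p, 0) \<in> S"
    using assms(1) by (auto simp: valid_states_def)
  then have "(0, t q) \<in> step s t S" "(s p, 0) \<in> step s t S"
    by (auto simp: step_iff)
  moreover have "step s t S \<subseteq> {..<m} \<times> {..<n}"
    using assms by (auto simp: valid_states_def step_def Pi_iff)
  ultimately show ?thesis
    by (auto simp: valid_states_def)
qed

text \<open>Reading the two letters backwards from \<open>{(0, 0)}\<close> yields \<open>{(0, q)}\<close> and then \<open>{(p, q)}\<close>:
  in each letter one component never takes the required value, so only the other one can move.\<close>

lemma separating_letters:
  assumes "c \<noteq> q"
  shows "(0, 0) \<in> step (\<lambda>_. 1) (\<lambda>y. if y = q then 0 else 1)
      (step (\<lambda>x. if x = p then 0 else 1) (\<lambda>_. c) S) \<longleftrightarrow> (p :: nat, q :: nat) \<in> S"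
  using assms by (auto simp: step_iff split: if_splits)

text \<open>The letters number all pairs of transformations, and both automata have 0 as initial and
  only final state. In their subset automaton \<open>C\<close> all valid states are reachable by
  \<open>reachable_all\<close>, and any two are separated by a two-letter word.\<close>

lemma shuffle_bound_attained:
  fixes m n :: nat
  assumes mn: "2 \<le> m" "2 \<le> n" and bounds: "m \<le> 5 \<or> n \<le> 5 \<or> m = 6 \<and> n = 6"
  shows "\<exists>(\<Sigma> :: nat set) K L.
    finite \<Sigma> \<and> regular_over \<Sigma> K \<and> regular_over \<Sigma> L \<and>
    state_complexity \<Sigma> K = m \<and> state_complexity \<Sigma> L = n \<and>
    state_complexity \<Sigma> (shuffle_lang K L) = shuffle_bound m n"
proof -
  \<comment> \<open>Extensional functions make this set finite. Letters therefore agree with given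
    maps only on \<open>{..<m}\<close> and \<open>{..<n}\<close>, which suffices on valid
    states.\<close>
  let ?F = "({..<m} \<rightarrow>\<^sub>E {..<m}) \<times> ({..<n} \<rightarrow>\<^sub>E {..<n})"
  have "finite ?F"
    by (intro finite_cartesian_product finite_PiE) auto
  then obtain e where e: "bij_betw e {0..<card ?F} ?F"
    using ex_bij_betw_nat_finite by blast
  define \<Sigma> where "\<Sigma> = {0..<card ?F}"
  define A where "A = \<lparr>states = {..<m}, init = 0, final = {0}, delta = (\<lambda>q a. fst (e a) q)\<rparr>"
  define B where "B = \<lparr>states = {..<n}, init = 0, final = {0}, delta = (\<lambda>q a. snd (e a) q)\<rparr>"
  define C where "C = \<lparr>states = valid_states m n, init = {(0, 0)},
    final = {S \<in> valid_states m n. (0, 0) \<in> S},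
    delta = (\<lambda>S a. step (fst (e a)) (snd (e a)) S)\<rparr>"
  have sel [simp]: "states A = {..<m}" "init A = 0" "final A = {0}" "delta A q a = fst (e a) q"
    "states B = {..<n}" "init B = 0" "final B = {0}" "delta B q a = snd (e a) q"
    "states C = valid_states m n" "init C = {(0, 0)}" "final C = {S \<in> valid_states m n. (0, 0) \<in> S}"
    "delta C S a = step (fst (e a)) (snd (e a)) S" for q a S
    by (simp_all add: A_def B_def C_def)
  have eF: "fst (e a) \<in> {..<m} \<rightarrow>\<^sub>E {..<m}" "snd (e a) \<in> {..<n} \<rightarrow>\<^sub>E {..<n}" if "a \<in> \<Sigma>" for a
  proof -
    have "e a \<in> ?F"
      using bij_betwE[OF e] that by (simp add: \<Sigma>_def)
    then show "fst (e a) \<in> {..<m} \<rightarrow>\<^sub>E {..<m}" "snd (e a) \<in> {..<n} \<rightarrow>\<^sub>E {..<n}"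
      by (simp_all add: mem_Times_iff)
  qed
  have letter: "\<exists>a\<in>\<Sigma>. (\<forall>i<m. fst (e a) i = s i) \<and> (\<forall>j<n. snd (e a) j = t j)"
    if "s \<in> {..<m} \<rightarrow> {..<m}" "t \<in> {..<n} \<rightarrow> {..<n}" for s t
  proof -
    have "(restrict s {..<m}, restrict t {..<n}) \<in> e ` {0..<card ?F}"
      using that e by (auto simp: bij_betw_def)
    then obtain a where "a \<in> \<Sigma>" "e a = (restrict s {..<m}, restrict t {..<n})"
      by (auto simp: \<Sigma>_def)
    then show ?thesis
      by (intro bexI[of _ a]) auto
  qed
  have step_letter: "\<exists>a\<in>\<Sigma>. \<forall>S\<in>valid_states m n. step (fst (e a)) (snd (e a)) S = step s t S"
    if st: "s \<in> {..<m} \<rightarrow> {..<m}" "t \<in> {..<n} \<rightarrow> {..<n}" for s t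
  proof -
    obtain a where a: "a \<in> \<Sigma>" "\<forall>i<m. fst (e a) i = s i" "\<forall>j<n. snd (e a) j = t j"
      using letter[OF st] by blast
    have "step (fst (e a)) (snd (e a)) S = step s t S" if "S \<in> valid_states m n" for S
    proof -
      have "map_prod (fst (e a)) id ` S = map_prod s id ` S" "map_prod id (snd (e a)) ` S = map_prod id t ` S"
        using a(2,3) that by (auto simp: valid_states_def intro!: image_cong)
      then show ?thesis
        by (simp add: step_def)
    qed
    with a(1) show ?thesis
      by blast
  qed
  have cA: "complete_dfa \<Sigma> A" and cB: "complete_dfa \<Sigma> B"
    using eF mn by (auto simp: complete_dfa_def PiE_iff)
  have finV: "finite (valid_states m n)"
    by (rule finite_subset[of _ "Pow ({..<m} \<times> {..<n})"]) (auto simp: valid_states_def)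
  have cC: "complete_dfa \<Sigma> C"
    unfolding complete_dfa_def
  proof (intro conjI ballI)
    show "init C \<in> states C"
      using mn by (auto simp: valid_states_def)
    show "delta C S a \<in> states C" if "S \<in> states C" "a \<in> \<Sigma>" for S a
      using that eF[OF that(2)] by (auto intro!: step_valid_states simp: PiE_def)
  qed (use finV in auto)
  have scA: "state_complexity \<Sigma> (dfa_lang \<Sigma> A) = m"
  proof -
    have "state_complexity \<Sigma> (dfa_lang \<Sigma> A) = card (states A)"
    proof (rule state_complexity_minimal[OF cA])
      fix q assume "q \<in> states A"
      then obtain a where "a \<in> \<Sigma>" "\<forall>i<m. fst (e a) i = q"
        using letter[of "\<lambda>_. q" id] by auto
      then show "\<exists>w\<in>lists \<Sigma>. foldl (delta A) (init A) w = q"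
        using mn by (intro bexI[of _ "[a]"]) auto
    next
      fix p q assume "p \<in> states A" "q \<in> states A" "p \<noteq> q"
      moreover obtain a where "a \<in> \<Sigma>" "\<forall>i<m. fst (e a) i = (if i = p then 0 else 1)"
        using letter[of "\<lambda>i. if i = p then 0 else 1" id] mn by auto
      ultimately show "\<exists>w\<in>lists \<Sigma>. (foldl (delta A) p w \<in> final A) \<noteq> (foldl (delta A) q w \<in> final A)"
        by (intro bexI[of _ "[a]"]) auto
    qed
    then show ?thesis
      by simp
  qed
  have scB: "state_complexity \<Sigma> (dfa_lang \<Sigma> B) = n"
  proof -
    have "state_complexity \<Sigma> (dfa_lang \<Sigma> B) = card (states B)"
    proof (rule state_complexity_minimal[OF cB])
      fix q assume "q \<in> states B"
      then obtain a where "a \<in> \<Sigma>" "\<forall>i<n. snd (e a) i = q"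
        using letter[of id "\<lambda>_. q"] by auto
      then show "\<exists>w\<in>lists \<Sigma>. foldl (delta B) (init B) w = q"
        using mn by (intro bexI[of _ "[a]"]) auto
    next
      fix p q assume "p \<in> states B" "q \<in> states B" "p \<noteq> q"
      moreover obtain a where "a \<in> \<Sigma>" "\<forall>i<n. snd (e a) i = (if i = p then 0 else 1)"
        using letter[of id "\<lambda>i. if i = p then 0 else 1"] mn by auto
      ultimately show "\<exists>w\<in>lists \<Sigma>. (foldl (delta B) p w \<in> final B) \<noteq> (foldl (delta B) q w \<in> final B)"
        by (intro bexI[of _ "[a]"]) auto
    qed
    then show ?thesis
      by simp
  qed
  have runC: "foldl (delta C) S w \<in> valid_states m n" if "w \<in> lists \<Sigma>" "S \<in> valid_states m n" for w S
    using that
  proof (induction w arbitrary: S)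
    case (Cons a w)
    then have "delta C S a \<in> valid_states m n"
      using cC by (auto simp: complete_dfa_def)
    then show ?case
      using Cons by simp
  qed simp
  have startC: "{(0, 0)} \<in> valid_states m n"
    using mn by (auto simp: valid_states_def)
  have deltaC: "delta C = (\<lambda>S a. step (\<lambda>p. delta A p a) (\<lambda>q. delta B q a) S)"
    by (intro ext) simp
  have langC: "dfa_lang \<Sigma> C = shuffle_lang (dfa_lang \<Sigma> A) (dfa_lang \<Sigma> B)"
  proof (intro set_eqI)
    fix w
    have "w \<in> dfa_lang \<Sigma> C \<longleftrightarrow> w \<in> lists \<Sigma> \<and> (0, 0) \<in> foldl (delta C) {(0, 0)} w"
      using runC[OF _ startC] by (auto simp: dfa_lang_def simp del: sel(12))
    also have "\<dots> \<longleftrightarrow> w \<in> lists \<Sigma> \<and> (\<exists>u v. w \<in> shuffles u v \<and> foldl (delta A) 0 u = 0 \<and> foldl (delta B) 0 v = 0)"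
      unfolding deltaC foldl_step_iff by (auto simp del: sel)
    also have "\<dots> \<longleftrightarrow> w \<in> shuffle_lang (dfa_lang \<Sigma> A) (dfa_lang \<Sigma> B)"
    proof -
      have "w \<in> lists \<Sigma> \<longleftrightarrow> u \<in> lists \<Sigma> \<and> v \<in> lists \<Sigma>" if "w \<in> shuffles u v" for u v
        using set_shuffles[OF that] by (auto simp: in_lists_conv_set)
      then show ?thesis
        unfolding shuffle_lang_def dfa_lang_def by (simp del: in_listsI in_lists_conv_set) blast
    qed
    finally show "w \<in> dfa_lang \<Sigma> C \<longleftrightarrow> w \<in> shuffle_lang (dfa_lang \<Sigma> A) (dfa_lang \<Sigma> B)" .
  qed
  have reachC: "\<exists>w\<in>lists \<Sigma>. foldl (delta C) {(0, 0)} w = S" if "reachable m n S" for S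
    using that
  proof (induction rule: reachable.induct)
    case start
    show ?case
      by (intro bexI[of _ "[]"]) auto
  next
    case (step S s t)
    then obtain w where w: "w \<in> lists \<Sigma>" "foldl (delta C) {(0, 0)} w = S"
      by blast
    then have "S \<in> valid_states m n"
      using runC[OF _ startC] by blast
    then obtain a where a: "a \<in> \<Sigma>" "step (fst (e a)) (snd (e a)) S = step s t S"
      using step_letter[OF step(2,3)] by blast
    have "foldl (delta C) {(0, 0)} (w @ [a]) = delta C S a"
      using w(2) by (simp only: foldl_append foldl.simps)
    then have "foldl (delta C) {(0, 0)} (w @ [a]) = step s t S"
      using a(2) by (simp only: sel)
    moreover have "w @ [a] \<in> lists \<Sigma>"
      using w(1) a(1) by simp
    ultimately show ?case
      by blast
  qed
  have "state_complexity \<Sigma> (dfa_lang \<Sigma> C) = card (states C)"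
  proof (rule state_complexity_minimal[OF cC])
    fix S assume "S \<in> states C"
    then have "reachable m n S"
      using bounds by (intro reachable_all) (auto simp: valid_states_def)
    then show "\<exists>w\<in>lists \<Sigma>. foldl (delta C) (init C) w = S"
      using reachC by simp
  next
    have sep: "\<exists>w\<in>lists \<Sigma>. (foldl (delta C) S w \<in> final C) \<noteq> (foldl (delta C) S' w \<in> final C)"
      if S: "S \<in> valid_states m n" "S' \<in> valid_states m n" "(p, q) \<in> S" "(p, q) \<notin> S'" for S S' p q
    proof -
      \<comment> \<open>A constant column value different from \<open>q\<close>, as
        \<open>separating_letters\<close> requires; it is below \<open>n\<close> because
        \<open>2 \<le> n\<close>.\<close>
      define c where "c = (if q = 0 then 1 else 0 :: nat)"
      have "c \<noteq> q"
        by (simp add: c_def)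
      let ?s\<^sub>1 = "\<lambda>x. if x = p then 0 else 1 :: nat" and ?t\<^sub>1 = "\<lambda>_ :: nat. c"
      let ?s\<^sub>2 = "\<lambda>_ :: nat. 1 :: nat" and ?t\<^sub>2 = "\<lambda>y. if y = q then 0 else 1 :: nat"
      have maps: "?s\<^sub>1 \<in> {..<m} \<rightarrow> {..<m}" "?t\<^sub>1 \<in> {..<n} \<rightarrow> {..<n}" "?s\<^sub>2 \<in> {..<m} \<rightarrow> {..<m}" "?t\<^sub>2 \<in> {..<n} \<rightarrow> {..<n}"
        using mn by (auto simp: c_def)
      obtain a where a: "a \<in> \<Sigma>" "\<forall>S\<in>valid_states m n. step (fst (e a)) (snd (e a)) S = step ?s\<^sub>1 ?t\<^sub>1 S"
        using step_letter[OF maps(1,2)] by blast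
      obtain b where b: "b \<in> \<Sigma>" "\<forall>S\<in>valid_states m n. step (fst (e b)) (snd (e b)) S = step ?s\<^sub>2 ?t\<^sub>2 S"
        using step_letter[OF maps(3,4)] by blast
      have "foldl (delta C) U [a, b] \<in> final C \<longleftrightarrow> (p, q) \<in> U" if U: "U \<in> valid_states m n" for U
      proof -
        have 1: "step ?s\<^sub>1 ?t\<^sub>1 U \<in> valid_states m n"
          by (rule step_valid_states[OF U maps(1,2)])
        have "foldl (delta C) U [a, b] = step ?s\<^sub>2 ?t\<^sub>2 (step ?s\<^sub>1 ?t\<^sub>1 U)"
          using a(2) b(2) U 1 by simp
        then show ?thesis
          using separating_letters[OF \<open>c \<noteq> q\<close>, of p U] step_valid_states[OF 1 maps(3,4)] by simp
      qed
      then show ?thesis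
        using S a(1) b(1) by (intro bexI[of _ "[a, b]"]) auto
    qed
    fix S S' assume S: "S \<in> states C" "S' \<in> states C" "S \<noteq> S'"
    then obtain p q where "(p, q) \<in> S \<and> (p, q) \<notin> S' \<or> (p, q) \<in> S' \<and> (p, q) \<notin> S"
      by auto
    then show "\<exists>w\<in>lists \<Sigma>. (foldl (delta C) S w \<in> final C) \<noteq> (foldl (delta C) S' w \<in> final C)"
      using sep[of S S' p q] sep[of S' S p q] S by (metis sel(9))
  qed
  then have "state_complexity \<Sigma> (shuffle_lang (dfa_lang \<Sigma> A) (dfa_lang \<Sigma> B)) = shuffle_bound m n"
    using card_valid_states[of m n] mn by (simp add: langC)
  moreover have "regular_over \<Sigma> (dfa_lang \<Sigma> A)" "regular_over \<Sigma> (dfa_lang \<Sigma> B)"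
    using cA cB unfolding regular_over_def by blast+
  moreover have "finite \<Sigma>"
    by (simp add: \<Sigma>_def)
  ultimately show ?thesis
    using scA scB by blast
qed

theorem mainTheorem2:
  fixes m n :: nat
  assumes "(2 \<le> m \<and> m \<le> 5 \<and> 2 \<le> n) \<or> (m = 6 \<and> n = 6)"
  shows "\<exists>(\<Sigma> :: nat set) K L.
    finite \<Sigma> \<and> regular_over \<Sigma> K \<and> regular_over \<Sigma> L \<and>
    state_complexity \<Sigma> K = m \<and> state_complexity \<Sigma> L = n \<and>
    state_complexity \<Sigma> (shuffle_lang K L) = shuffle_bound m n"
  using assms by (intro shuffle_bound_attained) auto

end
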